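(* Let $n > 2k \geq 4$ be integers. Let $h(n,k)$ denote the maximum of $|\mathcal F| + |\mathcal G|$ over all pairs of non-trivial cross-intersecting families $\mathcal F, \mathcal G \subset \binom{[n]}{k}$. Then $$h(n,k) = 2 + \binom{n}{k} - 2\binom{n-k}{k} + \binom{n-2k}{k}.$$ Moreover, for $k \geq 3$, up to a permutation of $[n]$ and interchanging the roles of $\mathcal F$ and $\mathcal G$, the only pair attaining this maximum is $\mathcal A = \{A_1, A_2\}$, $\mathcal B = \{B \in \binom{[n]}{k} : B \cap A_1 \neq \emptyset \text{ and } B \cap A_2 \neq \emptyset\}$, where $A_1, A_2 \in \binom{[n]}{k}$ are disjoint.
   Context: $[n] = \{1,\dots,n\}$ and $\binom{[n]}{k}$ is the collection of all $k$-element subsets of $[n]$. Two families $\mathcal F, \mathcal G$ are cross-intersecting if $F \cap G \neq \emptyset$ for all $F \in \mathcal F$, $G \in \mathcal G$. A (non-empty) family $\mathcal F$ is non-trivial if $\bigcap_{F \in \mathcal F} F = \emptyset$. *)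

theory Defs
  imports "HOL-Combinatorics.Permutations"
begin

definition ksubsets :: "nat \<Rightarrow> nat \<Rightarrow> nat set set" where
  "ksubsets n k = {A. A \<subseteq> {1..n} \<and> card A = k}"

definition cross_intersecting :: "'a set set \<Rightarrow> 'a set set \<Rightarrow> bool" where
  "cross_intersecting F G \<longleftrightarrow> (\<forall>A\<in>F. \<forall>B\<in>G. A \<inter> B \<noteq> {})"

definition nontrivial :: "'a set set \<Rightarrow> bool" where
  "nontrivial F \<longleftrightarrow> F \<noteq> {} \<and> \<Inter> F = {}"

definition h :: "nat \<Rightarrow> nat \<Rightarrow> nat" where
  "h n k = Max {card F + card G | F G. F \<subseteq> ksubsets n k \<and> G \<subseteq> ksubsets n k
      \<and> nontrivial F \<and> nontrivial G \<and> cross_intersecting F G}"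

definition ext_B :: "nat \<Rightarrow> nat \<Rightarrow> nat set \<Rightarrow> nat set \<Rightarrow> nat set set" where
  "ext_B n k A1 A2 = {B \<in> ksubsets n k. B \<inter> A1 \<noteq> {} \<and> B \<inter> A2 \<noteq> {}}"

end

theory Submission
  imports Defs
begin

text \<open>Take a pair of maximal total size and apply left shifts. If both families stay non-trivial
  until everything is shifted, then every member meets \<open>[k + 1]\<close> at least twice, and induction on
  \<open>n\<close> starting from the complement pairing at \<open>n = 2k\<close> works: the links of the last
  element contribute at most the number of \<open>(k - 1)\<close>-sets meeting \<open>[k + 1]\<close> twice, and these are
  transversals of a non-trivial family. Transversals of a non-trivial family of \<open>k\<close>-sets are
  at most as numerous as those of two disjoint \<open>k\<close>-sets.

  If instead shifting \<open>j\<close> to \<open>i\<close> makes \<open>F\<close> trivial, then every member of \<open>F\<close> meets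
  \<open>{i, j}\<close> and the pair splits along its traces on \<open>{i, j}\<close>: members of \<open>F\<close> containing only one of
  \<open>i\<close>, \<open>j\<close> against members of \<open>G\<close> containing only the other form non-empty cross-intersecting
  pairs, and members of \<open>F\<close> containing both against members of \<open>G\<close> containing neither are
  bounded by the same dichotomy, with equality only if \<open>F\<close> consists of two disjoint sets. Shifting
  preserves sizes, so equality always forces a family of size two.\<close>

section \<open>Transversals of families of bounded sets\<close>

text \<open>Deleting \<open>{i, j}\<close> from the members of \<open>F\<close> leaves sets of sizes
  \<open>k - 1\<close> and \<open>k - 2\<close>. Only those of size \<open>k - 2\<close> are counted
  against the members of \<open>G\<close> avoiding \<open>{i, j}\<close>, but those of size
  \<open>k - 1\<close> are what shows that no element is common to all. Hence the auxiliary bounds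
  speak of a family \<open>H\<close> of sets of size at most \<open>q\<close> of which a single
  layer of size \<open>a\<close> is counted. The bound \<open>two_set_count N q q b\<close> for that
  layer together with \<open>B\<close> reproduces itself when one point is deleted from each of two
  disjoint \<open>q\<close>-sets, which is why the induction there runs on \<open>q\<close>. The
  summand \<open>2\<close> of the final bound is \<open>1 + 1\<close>, one from each of the two
  non-empty cross-intersecting pairs of traces; at \<open>n = 2k\<close> it cancels
  \<open>2 * (k choose k)\<close> and leaves \<open>2k choose k\<close>, the complement bound. For
  \<open>k = 2\<close> uniqueness fails: the three \<open>2\<close>-subsets of a
  \<open>3\<close>-set, paired with themselves, have total \<open>6 = 2 + 4\<close>. Accordingly
  strictness requires \<open>k - 1 \<ge> 2\<close> in both branches of the dichotomy.\<close>

abbreviation subsets_of_card :: "'a set \<Rightarrow> nat \<Rightarrow> 'a set set" where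
  "subsets_of_card X b \<equiv> {T. T \<subseteq> X \<and> card T = b}"

lemma finite_subsets_of_card [simp]: "finite X \<Longrightarrow> finite {T. T \<subseteq> X \<and> card T = b \<and> Q T}"
  by (rule finite_subset[of _ "Pow X"]) auto

lemma finite_subsets_of_card' [simp]: "finite X \<Longrightarrow> finite (subsets_of_card X b)"
  using finite_subsets_of_card[of X b "\<lambda>_. True"] by simp

section \<open>Counting subsets that meet one or two given sets\<close>

lemma card_subsets_disjoint:
  assumes "finite X"
  shows "card {T. T \<subseteq> X \<and> card T = b \<and> T \<inter> e = {}} = (card X - card (e \<inter> X)) choose b"
proof -
  have "{T. T \<subseteq> X \<and> card T = b \<and> T \<inter> e = {}} = subsets_of_card (X - e) b" by auto
  moreover have "card (X - e) = card X - card (e \<inter> X)"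
    using assms by (simp add: card_Diff_subset_Int Int_commute)
  ultimately show ?thesis using n_subsets[of "X - e" b] assms by simp
qed

lemma card_subsets_meeting:
  assumes "finite X"
  shows "int (card {T. T \<subseteq> X \<and> card T = b \<and> T \<inter> e \<noteq> {}}) =
    int (card X choose b) - int ((card X - card (e \<inter> X)) choose b)"
proof -
  have "subsets_of_card X b = {T. T \<subseteq> X \<and> card T = b \<and> T \<inter> e \<noteq> {}} \<union> {T. T \<subseteq> X \<and> card T = b \<and> T \<inter> e = {}}"
    by auto
  then have "card (subsets_of_card X b) = card {T. T \<subseteq> X \<and> card T = b \<and> T \<inter> e \<noteq> {}}
      + card {T. T \<subseteq> X \<and> card T = b \<and> T \<inter> e = {}}"
    using assms by (subst card_Un_disjoint[symmetric]) auto
  then show ?thesis using card_subsets_disjoint[OF assms] n_subsets[OF assms] by simp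
qed

lemma card_subsets_meeting_le:
  assumes "finite X" "card (e \<inter> X) \<le> q"
  shows "int (card {T. T \<subseteq> X \<and> card T = b \<and> T \<inter> e \<noteq> {}}) \<le>
    int (card X choose b) - int ((card X - q) choose b)"
proof -
  have "(card X - q) choose b \<le> (card X - card (e \<inter> X)) choose b"
    using assms(2) by (intro binomial_right_mono) auto
  then show ?thesis using card_subsets_meeting[OF assms(1), of b e] by linarith
qed

text \<open>For \<open>m + q \<le> N\<close> this is, by inclusion-exclusion, the number of
  \<open>b\<close>-subsets of an \<open>N\<close>-set that meet both of two disjoint sets of sizes
  \<open>m\<close> and \<open>q\<close>. Integer values keep the differences of binomial
  coefficients from being truncated.\<close>

definition two_set_count :: "nat \<Rightarrow> nat \<Rightarrow> nat \<Rightarrow> nat \<Rightarrow> int" where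
  "two_set_count N m q b = int (N choose b) - int ((N - m) choose b) - int ((N - q) choose b)
     + int ((N - m - q) choose b)"

lemma card_subsets_meeting_two:
  assumes "finite X" "Q \<subseteq> X" "R \<subseteq> X" "Q \<inter> R = {}"
  shows "int (card {T. T \<subseteq> X \<and> card T = b \<and> T \<inter> Q \<noteq> {} \<and> T \<inter> R \<noteq> {}}) =
    two_set_count (card X) (card Q) (card R) b"
proof -
  have fin: "finite Q" "finite R" using assms finite_subset by blast+
  have int: "Q \<inter> X = Q" "R \<inter> X = R" "(Q \<union> R) \<inter> X = Q \<union> R" using assms by auto
  have "{T. T \<subseteq> X \<and> card T = b \<and> T \<inter> (Q \<union> R) \<noteq> {}} \<union> {T. T \<subseteq> X \<and> card T = b \<and> T \<inter> Q \<noteq> {} \<and> T \<inter> R \<noteq> {}}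
     = {T. T \<subseteq> X \<and> card T = b \<and> T \<inter> Q \<noteq> {}} \<union> {T. T \<subseteq> X \<and> card T = b \<and> T \<inter> R \<noteq> {}}"
    (is "?U \<union> ?I = ?A \<union> ?B") by auto
  moreover have "?I \<subseteq> ?U" "?I = ?A \<inter> ?B" "?U = ?A \<union> ?B" by auto
  moreover have "card ?A + card ?B = card (?A \<union> ?B) + card (?A \<inter> ?B)"
    using assms(1) by (intro card_Un_Int) auto
  ultimately have "card ?A + card ?B = card ?U + card ?I" by simp
  moreover have "card (Q \<union> R) = card Q + card R" using fin assms(4) by (simp add: card_Un_disjoint)
  moreover note card_subsets_meeting[OF assms(1), of b Q] card_subsets_meeting[OF assms(1), of b R]
    card_subsets_meeting[OF assms(1), of b "Q \<union> R"]
  ultimately show ?thesis unfolding two_set_count_def int by (simp add: diff_diff_left)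
qed

lemma choose_Suc_diff:
  assumes "b \<ge> 1" "N \<ge> 1"
  shows "int (N choose b) = int ((N - 1) choose b) + int ((N - 1) choose (b - 1))"
  using assms by (cases N; cases b) auto

text \<open>Delete a point of the \<open>m\<close>-set: a \<open>b\<close>-set through it only has
  to meet the \<open>q\<close>-set with its other \<open>b - 1\<close> elements. The inequality
  \<open>transversal_step\<close> has the same shape.\<close>

lemma two_set_count_remove_left:
  assumes "b \<ge> 1" "m \<ge> 1" "m + q \<le> N"
  shows "two_set_count N m q b = two_set_count (N - 1) (m - 1) q b
     + (int ((N - 1) choose (b - 1)) - int ((N - 1 - q) choose (b - 1)))"
proof -
  have *: "N - 1 - (m - 1) = N - m" "N - 1 - q = N - q - 1" using assms by auto
  have **: "N \<ge> 1" "N - q \<ge> 1" using assms by auto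
  show ?thesis unfolding two_set_count_def * **[THEN choose_Suc_diff[OF assms(1)]]
    by (simp add: diff_commute)
qed

lemma two_set_count_remove_outside:
  assumes "b \<ge> 1" "m + q < N"
  shows "two_set_count N m q b = two_set_count (N - 1) m q b + two_set_count (N - 1) m q (b - 1)"
proof -
  have *: "N - 1 - m = N - m - 1" "N - 1 - q = N - q - 1" "N - 1 - m - q = N - m - q - 1" by auto
  have **: "N \<ge> 1" "N - m \<ge> 1" "N - q \<ge> 1" "N - m - q \<ge> 1" using assms by auto
  show ?thesis unfolding two_set_count_def * **[THEN choose_Suc_diff[OF assms(1)]] by simp
qed

text \<open>Delete one point of each set. A \<open>b\<close>-set containing both is unrestricted,
  one containing exactly one must still meet the remaining \<open>q\<close> points of the other set,
  and one containing neither faces the same problem with \<open>q\<close>.\<close>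

lemma two_set_count_remove_both:
  assumes "b \<ge> 2" "2 * q + 2 \<le> N"
  shows "two_set_count N (Suc q) (Suc q) b = int ((N - 2) choose (b - 2))
     + 2 * (int ((N - 2) choose (b - 1)) - int ((N - 2 - q) choose (b - 1))) + two_set_count (N - 2) q q b"
proof -
  define c where "c = b - 2"
  have b: "b = Suc (Suc c)" using assms(1) by (simp add: c_def)
  define M where "M = N - 2"
  have N: "N = Suc (Suc M)" using assms(2) by (simp add: M_def)
  have *: "Suc (Suc M) - Suc q = Suc (M - q)" "Suc (Suc M) - Suc q - Suc q = M - q - q"
    "Suc (Suc M) - 2 = M" "Suc (Suc c) - 2 = c" "Suc (Suc c) - 1 = Suc c"
    using assms by (auto simp: N)
  show ?thesis unfolding two_set_count_def b N * binomial_Suc_Suc by simp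
qed

lemma two_set_count_no_first: "two_set_count N 0 q b = 0"
  unfolding two_set_count_def by simp

lemma card_split_elem:
  assumes "finite S"
  shows "card S = card {T \<in> S. x \<notin> T} + card {T \<in> S. x \<in> T}"
proof -
  have "S = {T \<in> S. x \<notin> T} \<union> {T \<in> S. x \<in> T}" by auto
  then show ?thesis using assms by (subst card_Un_disjoint[symmetric]) auto
qed

lemma card_image_remove_elem: "card ((\<lambda>T. T - {x}) ` {T \<in> S. x \<in> T}) = card {T \<in> S. x \<in> T}"
  by (intro card_image inj_onI) auto

lemma card_containing_meeting_le:
  assumes "finite X" "x \<in> X" "x \<notin> e" "card (e \<inter> (X - {x})) \<le> q"
  shows "int (card {T. T \<subseteq> X \<and> card T = b \<and> x \<in> T \<and> T \<inter> e \<noteq> {}}) \<le>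
    int ((card X - 1) choose (b - 1)) - int ((card X - 1 - q) choose (b - 1))"
proof -
  let ?S = "{T. T \<subseteq> X \<and> card T = b \<and> T \<inter> e \<noteq> {}}"
  have "(\<lambda>T. T - {x}) ` {T \<in> ?S. x \<in> T} \<subseteq> {T. T \<subseteq> X - {x} \<and> card T = b - 1 \<and> T \<inter> e \<noteq> {}}"
    using assms(3) by (auto simp: card_Diff_singleton)
  then have "card ((\<lambda>T. T - {x}) ` {T \<in> ?S. x \<in> T}) \<le> card {T. T \<subseteq> X - {x} \<and> card T = b - 1 \<and> T \<inter> e \<noteq> {}}"
    using assms(1) by (intro card_mono) auto
  moreover have "{T \<in> ?S. x \<in> T} = {T. T \<subseteq> X \<and> card T = b \<and> x \<in> T \<and> T \<inter> e \<noteq> {}}" by auto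
  moreover have "card (X - {x}) = card X - 1" using assms by simp
  ultimately show ?thesis
    using card_subsets_meeting_le[of "X - {x}" e q "b - 1"] card_image_remove_elem[of x ?S] assms by simp
qed

text \<open>Classify the transversals of \<open>H\<close> by the first element \<open>x\<close> of \<open>Q\<close> they contain: such a
  transversal still has to meet some \<open>e \<in> H\<close> avoiding \<open>x\<close>.\<close>

lemma transversal_step:
  assumes "finite X" "Q \<subseteq> X" "x \<in> Q" "e \<in> H" "x \<notin> e" "card (e \<inter> X) \<le> q" "b \<ge> 1"
  shows "int (card {T. T \<subseteq> X \<and> card T = b \<and> T \<inter> Q \<noteq> {} \<and> (\<forall>e\<in>H. T \<inter> e \<noteq> {})})
    \<le> int (card {T. T \<subseteq> X - {x} \<and> card T = b \<and> T \<inter> (Q - {x}) \<noteq> {} \<and> (\<forall>e\<in>H. T \<inter> e \<noteq> {})})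
     + (int ((card X - 1) choose (b - 1)) - int ((card X - 1 - q) choose (b - 1)))"
proof -
  let ?S = "{T. T \<subseteq> X \<and> card T = b \<and> T \<inter> Q \<noteq> {} \<and> (\<forall>e\<in>H. T \<inter> e \<noteq> {})}"
  have "{T \<in> ?S. x \<notin> T} = {T. T \<subseteq> X - {x} \<and> card T = b \<and> T \<inter> (Q - {x}) \<noteq> {} \<and> (\<forall>e\<in>H. T \<inter> e \<noteq> {})}"
    by auto
  moreover have "card {T \<in> ?S. x \<in> T} \<le> card {T. T \<subseteq> X \<and> card T = b \<and> x \<in> T \<and> T \<inter> e \<noteq> {}}"
    using assms by (intro card_mono) auto
  moreover have "e \<inter> (X - {x}) = e \<inter> X" using assms(5) by auto
  ultimately show ?thesis
    using card_split_elem[of ?S x] card_containing_meeting_le[of X x e q b] assms(1,5,6)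
      subsetD[OF assms(2,3)] by simp
qed

text \<open>Induction on \<open>m\<close>, deleting one point of \<open>Q\<close> at a time from
  \<open>Q\<close> and \<open>X\<close>. The claim keeps its shape because \<open>Q\<close> is held
  apart from \<open>H\<close>, whose members never change and only have to be small inside the
  current \<open>X\<close>. A single \<open>q\<close>-set disjoint from \<open>Q\<close> as
  \<open>H\<close> attains the bound.\<close>

lemma card_transversals_le:
  assumes "finite X" "Q \<subseteq> X" "card Q = m" "m + q \<le> card X" "b \<ge> 1"
    and "\<And>x. x \<in> Q \<Longrightarrow> \<exists>e\<in>H. x \<notin> e \<and> card (e \<inter> X) \<le> q"
  shows "int (card {T. T \<subseteq> X \<and> card T = b \<and> T \<inter> Q \<noteq> {} \<and> (\<forall>e\<in>H. T \<inter> e \<noteq> {})})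
    \<le> two_set_count (card X) m q b"
  using assms
proof (induction m arbitrary: X Q)
  case 0
  then have "Q = {}" using finite_subset[of Q X] by auto
  then show ?case by (simp add: two_set_count_no_first)
next
  case (Suc m)
  then obtain x where x: "x \<in> Q" by fastforce
  then obtain e where e: "e \<in> H" "x \<notin> e" "card (e \<inter> X) \<le> q" using Suc.prems by blast
  have mono: "card (e \<inter> (X - {x})) \<le> card (e \<inter> X)" for e
    using Suc.prems(1) by (intro card_mono) auto
  have cX: "card (X - {x}) = card X - 1" using Suc.prems(1,2) x by auto
  have "int (card {T. T \<subseteq> X - {x} \<and> card T = b \<and> T \<inter> (Q - {x}) \<noteq> {} \<and> (\<forall>e\<in>H. T \<inter> e \<noteq> {})})
    \<le> two_set_count (card (X - {x})) m q b"
  proof (rule Suc.IH)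
    show "card (Q - {x}) = m" using Suc.prems(2,3) x by (simp add: card_Diff_singleton)
    show "\<exists>e\<in>H. y \<notin> e \<and> card (e \<inter> (X - {x})) \<le> q" if "y \<in> Q - {x}" for y
      using Suc.prems(6)[of y] mono that by (meson DiffD1 le_trans)
  qed (use Suc.prems(1,2,4,5) cX in auto)
  then show ?case
    using transversal_step[OF Suc.prems(1,2) x e Suc.prems(5)]
      two_set_count_remove_left[of b "Suc m" q "card X"] Suc.prems(4,5) cX by simp
qed

lemma choose_strict: "\<lbrakk>b \<ge> 1; N + 1 \<ge> b\<rbrakk> \<Longrightarrow> N choose b < (N + 1) choose b"
  by (cases b) (auto simp: zero_less_binomial_iff)

text \<open>The order of deletion matters. Removing \<open>y\<close> first costs the usual amount,
  but \<open>e\<close> then has at most \<open>q - 1\<close> points left, so fewer transversals pass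
  through \<open>x\<close> than the bound allows. The condition \<open>q + b \<le> card X\<close>
  makes this saving positive.\<close>

lemma card_transversals_less:
  assumes "finite X" "Q \<subseteq> X" "card Q = m" "m + q \<le> card X" "b \<ge> 2" "q + b \<le> card X"
    and cov: "\<And>x. x \<in> Q \<Longrightarrow> \<exists>e\<in>H. x \<notin> e \<and> card (e \<inter> X) \<le> q"
    and xy: "x \<in> Q" "y \<in> Q" "e \<in> H" "x \<notin> e" "y \<in> e" "card (e \<inter> X) \<le> q"
  shows "int (card {T. T \<subseteq> X \<and> card T = b \<and> T \<inter> Q \<noteq> {} \<and> (\<forall>e\<in>H. T \<inter> e \<noteq> {})})
    < two_set_count (card X) m q b"
proof -
  let ?N = "card X"
  obtain e' where e': "e' \<in> H" "y \<notin> e'" "card (e' \<inter> X) \<le> q" using cov xy(2) by blast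
  have xney: "x \<noteq> y" using xy by auto
  have finQ: "finite Q" using assms finite_subset by blast
  have c2: "card {x, y} \<le> card Q" using finQ xy by (intro card_mono) auto
  then have m2: "m \<ge> 2" using xney assms(3) by simp
  have q1: "q \<ge> 1"
  proof -
    have "card {y} \<le> card (e \<inter> X)" using xy assms(1,2) by (intro card_mono) auto
    then show ?thesis using xy(6) by simp
  qed
  have cX: "card (X - {y}) = ?N - 1" "card (X - {y} - {x}) = ?N - 2"
    using assms(1,2) xy xney by (auto simp: card_Diff_singleton numeral_2_eq_2 subset_iff)
  have cq: "card (e \<inter> (X - {y})) \<le> q - 1"
  proof -
    have "e \<inter> (X - {y}) = (e \<inter> X) - {y}" by auto
    moreover have "y \<in> e \<inter> X" using xy assms(2) by auto
    ultimately show ?thesis using xy(6) assms(1) by (simp add: card_Diff_singleton)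
  qed
  have mono: "card (e \<inter> (X - {y} - {x})) \<le> card (e \<inter> X)" for e
    using assms(1) by (intro card_mono) auto
  have f1: "int (card {T. T \<subseteq> X - {y} - {x} \<and> card T = b \<and> T \<inter> (Q - {y} - {x}) \<noteq> {} \<and> (\<forall>e\<in>H. T \<inter> e \<noteq> {})})
    \<le> two_set_count (?N - 2) (m - 2) q b"
    unfolding cX(2)[symmetric]
  proof (rule card_transversals_le)
    show "card (Q - {y} - {x}) = m - 2" using xy xney finQ assms(3) by (simp add: card_Diff_singleton)
    show "\<exists>e\<in>H. z \<notin> e \<and> card (e \<inter> (X - {y} - {x})) \<le> q" if "z \<in> Q - {y} - {x}" for z
      using cov[of z] mono that by (meson DiffD1 le_trans)
  qed (use assms(1,2,4,5) cX m2 in auto)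
  have f2: "int (card {T. T \<subseteq> X - {y} \<and> card T = b \<and> T \<inter> (Q - {y}) \<noteq> {} \<and> (\<forall>e\<in>H. T \<inter> e \<noteq> {})})
    \<le> int (card {T. T \<subseteq> X - {y} - {x} \<and> card T = b \<and> T \<inter> (Q - {y} - {x}) \<noteq> {} \<and> (\<forall>e\<in>H. T \<inter> e \<noteq> {})})
     + (int ((?N - 2) choose (b - 1)) - int ((?N - 2 - (q - 1)) choose (b - 1)))"
    using transversal_step[of "X - {y}" "Q - {y}" x e H "q - 1" b, OF _ _ _ xy(3,4) cq] assms(1,2,5) xy(1) xney
    unfolding cX by (auto simp: numeral_2_eq_2)
  have f3: "int (card {T. T \<subseteq> X \<and> card T = b \<and> T \<inter> Q \<noteq> {} \<and> (\<forall>e\<in>H. T \<inter> e \<noteq> {})})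
    \<le> int (card {T. T \<subseteq> X - {y} \<and> card T = b \<and> T \<inter> (Q - {y}) \<noteq> {} \<and> (\<forall>e\<in>H. T \<inter> e \<noteq> {})})
     + (int ((?N - 1) choose (b - 1)) - int ((?N - 1 - q) choose (b - 1)))"
    using transversal_step[OF assms(1,2) xy(2) e', of b] assms(5) by simp
  have f4: "int (?N - 2 - q choose (b - 1)) < int (?N - 2 - (q - 1) choose (b - 1))"
  proof -
    have *: "?N - 2 - (q - 1) = (?N - 2 - q) + 1" using q1 m2 assms(4) by linarith
    show ?thesis unfolding * of_nat_less_iff by (rule choose_strict) (use assms(5,6) in auto)
  qed
  have f5: "two_set_count ?N m q b = two_set_count (?N - 2) (m - 2) q b
     + (int ((?N - 2) choose (b - 1)) - int ((?N - 2 - q) choose (b - 1)))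
     + (int ((?N - 1) choose (b - 1)) - int ((?N - 1 - q) choose (b - 1)))"
    using two_set_count_remove_left[of b m q ?N] two_set_count_remove_left[of b "m - 1" q "?N - 1"] m2 assms(4,5)
    by (simp add: numeral_2_eq_2)
  \<comment> \<open>The two deletions are chained with the bound for the rest; the only strict
    inequality is the saving \<open>r' < r\<close>, which is \<open>f4\<close>.\<close>
  have "c < E" if "a \<le> t" "d \<le> a + (p - r)" "c \<le> d + s" "r' < r" "E = t + (p - r') + s"
    for a c d p r r' s t E :: int using that by linarith
  from this[OF f1 f2 f3 f4 f5] show ?thesis .
qed

section \<open>Shifting\<close>

definition shift_set :: "nat \<Rightarrow> nat \<Rightarrow> nat set set \<Rightarrow> nat set \<Rightarrow> nat set" where
  "shift_set i j F A = (if j \<in> A \<and> i \<notin> A \<and> insert i (A - {j}) \<notin> F then insert i (A - {j}) else A)"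

definition shift :: "nat \<Rightarrow> nat \<Rightarrow> nat set set \<Rightarrow> nat set set" where
  "shift i j F = shift_set i j F ` F"

definition shifted :: "nat set \<Rightarrow> nat set set \<Rightarrow> bool" where
  "shifted X F \<longleftrightarrow> (\<forall>T\<in>F. \<forall>j\<in>T. \<forall>i\<in>X. i < j \<and> i \<notin> T \<longrightarrow> insert i (T - {j}) \<in> F)"

lemma inj_on_shift_set: "inj_on (shift_set i j F) F"
  unfolding shift_set_def inj_on_def by (auto split: if_splits; blast)

lemma card_shift [simp]: "card (shift i j F) = card F"
  unfolding shift_def by (rule card_image[OF inj_on_shift_set])

lemma card_shift_set: "finite A \<Longrightarrow> card (shift_set i j F A) = card A"
  unfolding shift_set_def by (auto simp: card_Diff_singleton) (metis card_gt_0_iff empty_iff Suc_pred)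

lemma shift_subset_Pow: "F \<subseteq> Pow X \<Longrightarrow> i \<in> X \<Longrightarrow> shift i j F \<subseteq> Pow X"
  unfolding shift_def shift_set_def by (auto split: if_splits)

lemma shift_subsets_of_card:
  assumes "finite X" "F \<subseteq> subsets_of_card X a" "i \<in> X"
  shows "shift i j F \<subseteq> subsets_of_card X a"
proof
  fix T assume "T \<in> shift i j F"
  then obtain A where A: "A \<in> F" "T = shift_set i j F A" by (auto simp: shift_def)
  then have "finite A" using assms finite_subset by blast
  then have "card T = a" using A assms(2) card_shift_set by auto
  moreover have "T \<subseteq> X" using A assms by (auto simp: shift_set_def)
  ultimately show "T \<in> subsets_of_card X a" by simp
qed

lemma card_shift_of_card:
  assumes "finite X" "H \<subseteq> Pow X"
  shows "card {T \<in> shift i j H. card T = a} = card {T \<in> H. card T = a}"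
proof -
  have "card (shift_set i j H T) = card T" if "T \<in> H" for T
    using card_shift_set[OF finite_subset[of T X]] that assms by blast
  then have "{T \<in> shift i j H. card T = a} = shift_set i j H ` {T \<in> H. card T = a}"
    by (auto simp: shift_def)
  moreover have "inj_on (shift_set i j H) {T \<in> H. card T = a}"
    using inj_on_shift_set by (rule inj_on_subset) auto
  ultimately show ?thesis by (simp add: card_image)
qed

lemma cross_intersectingD: "cross_intersecting F G \<Longrightarrow> A \<in> F \<Longrightarrow> B \<in> G \<Longrightarrow> A \<inter> B \<noteq> {}"
  by (auto simp: cross_intersecting_def)

lemma cross_intersecting_sym: "cross_intersecting F G \<Longrightarrow> cross_intersecting G F"
  by (fastforce simp: cross_intersecting_def)

text \<open>Here \<open>A\<close> moves and \<open>B\<close> stays. The critical case is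
  \<open>A \<inter> B = {j}\<close> with \<open>i \<notin> B\<close>: then \<open>B\<close> stayed
  only because its image is already in \<open>G\<close>, and a common point of that image with
  \<open>A\<close> is neither \<open>i\<close> nor \<open>j\<close>, a contradiction.\<close>

lemma cross_intersecting_shift_aux:
  assumes cross: "cross_intersecting F G" and A: "A \<in> F" "shift_set i j F A = insert i (A - {j})" "j \<in> A" "i \<notin> A"
    and B: "B \<in> G" "shift_set i j G B = B"
  shows "insert i (A - {j}) \<inter> B \<noteq> {}"
proof (cases "i \<in> B \<or> A \<inter> B \<noteq> {j}")
  case True
  then show ?thesis using cross_intersectingD[OF cross A(1) B(1)] by blast
next
  case False
  then have "j \<in> B" "i \<notin> B" by auto
  then have "insert i (B - {j}) \<in> G" using B by (auto simp: shift_set_def split: if_splits)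
  then show ?thesis using cross_intersectingD[OF cross A(1)] A False by blast
qed

lemma cross_intersecting_shift:
  assumes "cross_intersecting F G"
  shows "cross_intersecting (shift i j F) (shift i j G)"
proof -
  have "shift_set i j F A \<inter> shift_set i j G B \<noteq> {}" if A: "A \<in> F" and B: "B \<in> G" for A B
  proof (cases "shift_set i j F A = A"; cases "shift_set i j G B = B")
    assume "shift_set i j F A = A" "shift_set i j G B = B"
    then show ?thesis using cross_intersectingD[OF assms A B] by simp
  next
    assume *: "shift_set i j F A \<noteq> A" "shift_set i j G B = B"
    then have "shift_set i j F A = insert i (A - {j})" "j \<in> A" "i \<notin> A"
      by (auto simp: shift_set_def split: if_splits)
    then show ?thesis using cross_intersecting_shift_aux[OF assms A _ _ _ B *(2)] *(2) by simp
  next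
    assume *: "shift_set i j F A = A" "shift_set i j G B \<noteq> B"
    then have "shift_set i j G B = insert i (B - {j})" "j \<in> B" "i \<notin> B"
      by (auto simp: shift_set_def split: if_splits)
    then show ?thesis
      using cross_intersecting_shift_aux[OF cross_intersecting_sym[OF assms] B _ _ _ A *(1)] *(1)
      by (simp add: Int_commute)
  next
    assume "shift_set i j F A \<noteq> A" "shift_set i j G B \<noteq> B"
    then have "i \<in> shift_set i j F A" "i \<in> shift_set i j G B"
      by (auto simp: shift_set_def split: if_splits)
    then show ?thesis by blast
  qed
  then show ?thesis by (auto simp: cross_intersecting_def shift_def)
qed

text \<open>Termination measure: every shift with \<open>i < j\<close> that changes the family
  lowers it.\<close>

definition weight :: "nat set set \<Rightarrow> nat" where
  "weight F = (\<Sum>A\<in>F. \<Sum>A)"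

lemma sum_shift_set_le:
  assumes "finite A" "i < j"
  shows "\<Sum>(shift_set i j F A) \<le> \<Sum>A"
    and "shift_set i j F A \<noteq> A \<Longrightarrow> \<Sum>(shift_set i j F A) < \<Sum>A"
proof -
  have "\<Sum>(insert i (A - {j})) < \<Sum>A" if "j \<in> A" "i \<notin> A"
    using assms that by (simp add: sum.remove)
  then show "\<Sum>(shift_set i j F A) \<le> \<Sum>A"
    and "shift_set i j F A \<noteq> A \<Longrightarrow> \<Sum>(shift_set i j F A) < \<Sum>A"
    by (auto simp: shift_set_def less_imp_le split: if_splits)
qed

lemma weight_shift:
  assumes "finite X" "F \<subseteq> Pow X" "i < j"
  shows "weight (shift i j F) \<le> weight F"
    and "shift i j F \<noteq> F \<Longrightarrow> weight (shift i j F) < weight F"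
proof -
  have fin: "finite F" "\<And>A. A \<in> F \<Longrightarrow> finite A" using assms finite_subset by (blast, blast)
  have eq: "weight (shift i j F) = (\<Sum>A\<in>F. \<Sum>(shift_set i j F A))"
    unfolding weight_def shift_def by (simp add: sum.reindex[OF inj_on_shift_set])
  show "weight (shift i j F) \<le> weight F"
    unfolding eq unfolding weight_def using fin assms(3) by (intro sum_mono sum_shift_set_le)
  assume "shift i j F \<noteq> F"
  then obtain A where A: "A \<in> F" "shift_set i j F A \<noteq> A"
    unfolding shift_def by (metis image_cong image_ident)
  show "weight (shift i j F) < weight F" unfolding eq unfolding weight_def
    using fin assms(3) A
    by (intro sum_strict_mono_ex1 ballI bexI[of _ A] sum_shift_set_le) auto
qed

lemma shifted_if_shift_eq:
  assumes "\<And>i j. i \<in> X \<Longrightarrow> j \<in> X \<Longrightarrow> i < j \<Longrightarrow> shift i j F = F" "F \<subseteq> Pow X"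
  shows "shifted X F"
  unfolding shifted_def
proof (intro ballI impI)
  fix T j i assume T: "T \<in> F" "j \<in> T" "i \<in> X" "i < j \<and> i \<notin> T"
  show "insert i (T - {j}) \<in> F"
  proof (rule ccontr)
    assume *: "insert i (T - {j}) \<notin> F"
    then have "shift_set i j F T = insert i (T - {j})" using T by (simp add: shift_set_def)
    moreover have "shift_set i j F T \<in> F" using T assms unfolding shift_def by blast
    ultimately show False using * by simp
  qed
qed

text \<open>Induction on the total weight. \<open>P\<close> is pulled back from the shifted pair, so
  hypotheses that a shift may or may not preserve can stay inside \<open>P\<close> and be examined
  in each step.\<close>

lemma shift_induct [consumes 3, case_names shifted step]:
  assumes "finite X" "F \<subseteq> Pow X" "G \<subseteq> Pow X"
    and base: "\<And>F G. F \<subseteq> Pow X \<Longrightarrow> G \<subseteq> Pow X \<Longrightarrow> shifted X F \<Longrightarrow> shifted X G \<Longrightarrow> P F G"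
    and step: "\<And>F G i j. F \<subseteq> Pow X \<Longrightarrow> G \<subseteq> Pow X \<Longrightarrow> i \<in> X \<Longrightarrow> j \<in> X \<Longrightarrow> i < j \<Longrightarrow>
      P (shift i j F) (shift i j G) \<Longrightarrow> P F G"
  shows "P F G"
  using assms(2,3)
proof (induction "weight F + weight G" arbitrary: F G rule: less_induct)
  case less
  show ?case
  proof (cases "shifted X F \<and> shifted X G")
    case True
    then show ?thesis using base less.prems by blast
  next
    case False
    then obtain i j where ij: "i \<in> X" "j \<in> X" "i < j" "shift i j F \<noteq> F \<or> shift i j G \<noteq> G"
      using shifted_if_shift_eq less.prems by metis
    have "weight (shift i j F) + weight (shift i j G) < weight F + weight G"
      using weight_shift[OF assms(1) less.prems(1) ij(3)] weight_shift[OF assms(1) less.prems(2) ij(3)] ij(4)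
      by linarith
    then show ?thesis
      using step[OF less.prems ij(1-3)] less.hyps shift_subset_Pow less.prems ij by blast
  qed
qed

text \<open>A shift adds no element but \<open>i\<close>, so a new common element must be
  \<open>i\<close>. A member without \<open>i\<close> must then have moved, which requires that it
  contains \<open>j\<close> and that its image was absent.\<close>

lemma shift_common_element:
  assumes "y \<in> X" "\<exists>T\<in>H. y \<notin> T" "\<forall>T\<in>shift i j H. y \<in> T" "T \<in> H"
  shows "i \<in> T \<or> j \<in> T" and "\<lbrakk>j \<in> T; i \<notin> T\<rbrakk> \<Longrightarrow> insert i (T - {j}) \<notin> H"
proof -
  have all: "y \<in> shift_set i j H S" if "S \<in> H" for S using assms(3) that by (auto simp: shift_def)
  obtain S where S: "S \<in> H" "y \<notin> S" using assms(2) by blast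
  have yi: "y = i" using all[OF S(1)] S by (auto simp: shift_set_def split: if_splits)
  show "i \<in> T \<or> j \<in> T" "\<lbrakk>j \<in> T; i \<notin> T\<rbrakk> \<Longrightarrow> insert i (T - {j}) \<notin> H"
    using all[OF assms(4)] yi by (auto simp: shift_set_def split: if_splits)
qed

section \<open>Initial segments, and links of the last element\<close>

definition initial :: "nat set \<Rightarrow> nat set \<Rightarrow> bool" where
  "initial P X \<longleftrightarrow> P \<subseteq> X \<and> (\<forall>i\<in>P. \<forall>j\<in>X - P. i < j)"

lemma initial_exists:
  assumes "finite X" "p \<le> card X"
  shows "\<exists>P. initial P X \<and> card P = p"
  using assms
proof (induction "card X" arbitrary: X)
  case 0
  then show ?case by (auto simp: initial_def)
next
  case (Suc n)
  define x where "x = Max X"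
  have x: "x \<in> X" "\<And>y. y \<in> X - {x} \<Longrightarrow> y < x"
  proof -
    have "X \<noteq> {}" using Suc by auto
    then show "x \<in> X" unfolding x_def using Suc by (intro Max_in)
    show "y < x" if "y \<in> X - {x}" for y
      using that Max_ge[of X y] Suc.prems unfolding x_def by (auto simp: order_less_le)
  qed
  show ?case
  proof (cases "p = card X")
    case True
    then show ?thesis by (intro exI[of _ X]) (auto simp: initial_def)
  next
    case False
    have "n = card (X - {x})" using Suc x by simp
    then obtain P where P: "initial P (X - {x})" "card P = p"
      using Suc.hyps(1)[of "X - {x}"] Suc.prems Suc.hyps(2) False by auto
    have "initial P X" unfolding initial_def
    proof (intro conjI ballI)
      show "P \<subseteq> X" using P by (auto simp: initial_def)
      fix i j assume "i \<in> P" "j \<in> X - P"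
      then show "i < j" using P x by (cases "j = x") (auto simp: initial_def)
    qed
    then show ?thesis using P by blast
  qed
qed

text \<open>The elements of \<open>T\<close> outside \<open>R\<close> lie beyond \<open>P\<close>
  and so exceed every element of \<open>R\<close>. They are exchanged one by one for missing
  elements of \<open>R\<close>, which exist because \<open>T\<close> is no larger than
  \<open>R\<close>.\<close>

lemma shifted_push:
  assumes "finite X" "shifted X H" "initial P X" "R \<subseteq> P" "T \<in> H" "T \<subseteq> X" "T \<inter> P \<subseteq> R" "card T \<le> card R"
  shows "\<exists>T'\<in>H. T' \<subseteq> R"
  using assms(5-8)
proof (induction "card (T - R)" arbitrary: T rule: less_induct)
  case less
  have "P \<subseteq> X" using assms(3) by (simp add: initial_def)
  then have fin: "finite T" "finite R"
    using finite_subset[OF _ assms(1)] less.prems(2) assms(4) by auto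
  show ?case
  proof (cases "T \<subseteq> R")
    case True
    then show ?thesis using less by blast
  next
    case False
    then obtain j where j: "j \<in> T" "j \<notin> R" by blast
    have "\<not> R \<subseteq> T"
    proof
      assume "R \<subseteq> T"
      then have "R \<subset> T" using j by blast
      then have "card R < card T" by (rule psubset_card_mono[OF fin(1)])
      then show False using less.prems(4) by simp
    qed
    then obtain i where i: "i \<in> R" "i \<notin> T" by blast
    have "j \<in> X - P" using j less.prems(2,3) by blast
    moreover have "i \<in> P" using i assms(4) by blast
    ultimately have ij: "i < j" using assms(3) by (simp add: initial_def)
    have iX: "i \<in> X" using i assms(3,4) by (auto simp: initial_def)
    let ?T = "insert i (T - {j})"
    have "?T \<in> H" using assms(2) less.prems(1) i j ij iX unfolding shifted_def by blast
    moreover have "?T - R \<subset> T - R" using i j by auto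
    then have "card (?T - R) < card (T - R)" using fin by (intro psubset_card_mono) auto
    moreover have "?T \<subseteq> X" "?T \<inter> P \<subseteq> R" using less.prems i iX by auto
    moreover have "card ?T = card T"
      using card_Suc_Diff1[OF fin(1) j(1)] i fin(1) by simp
    ultimately show ?thesis using less.hyps[of ?T] less.prems(4) by simp
  qed
qed

abbreviation heavy :: "'a set \<Rightarrow> 'a set \<Rightarrow> nat \<Rightarrow> nat \<Rightarrow> 'a set set" where
  "heavy X P b c \<equiv> {T. T \<subseteq> X \<and> card T = b \<and> c \<le> card (T \<inter> P)}"

definition link :: "'a \<Rightarrow> 'a set set \<Rightarrow> 'a set set" where
  "link x F = (\<lambda>T. T - {x}) ` {T \<in> F. x \<in> T}"

lemma card_link: "card (link x F) = card {T \<in> F. x \<in> T}"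
  unfolding link_def by (rule card_image_remove_elem)

lemma link_subset:
  assumes "finite X" "F \<subseteq> subsets_of_card X a"
  shows "link x F \<subseteq> subsets_of_card (X - {x}) (a - 1)"
proof -
  have "card (T - {x}) = a - 1" if "T \<in> F" "x \<in> T" for T
  proof -
    have "finite T" "card T = a" using that assms finite_subset by blast+
    then show ?thesis using that by (simp add: card_Diff_singleton)
  qed
  then show ?thesis using assms by (auto simp: link_def)
qed

lemma shifted_del:
  "shifted X F \<Longrightarrow> shifted (X - {x}) {T \<in> F. x \<notin> T}"
  by (auto simp: shifted_def)

lemma shifted_link:
  assumes "shifted X F"
  shows "shifted (X - {x}) (link x F)"
  unfolding shifted_def
proof (intro ballI impI)
  fix T j i assume T: "T \<in> link x F" "j \<in> T" "i \<in> X - {x}" "i < j \<and> i \<notin> T"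
  then obtain S where S: "S \<in> F" "x \<in> S" "T = S - {x}" by (auto simp: link_def)
  then have "insert i (S - {j}) \<in> F" using assms T by (auto simp: shifted_def)
  moreover have "insert i (T - {j}) = insert i (S - {j}) - {x}" "x \<in> insert i (S - {j})" using S T by auto
  ultimately show "insert i (T - {j}) \<in> link x F" by (auto simp: link_def)
qed

text \<open>Two members meeting only in the last element \<open>x\<close> have a union of fewer than
  \<open>a + b\<close> elements, which misses some \<open>y < x\<close>. Moving \<open>x\<close> to
  \<open>y\<close> in the first would make it disjoint from the second.\<close>

lemma cross_intersecting_link:
  assumes "finite X" "x \<in> X" "\<And>y. y \<in> X - {x} \<Longrightarrow> y < x" "shifted X A"
    and "A \<subseteq> subsets_of_card X a" "B \<subseteq> subsets_of_card X b" "cross_intersecting A B" "a + b \<le> card X"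
  shows "cross_intersecting (link x A) (link x B)"
  unfolding cross_intersecting_def
proof (intro ballI notI)
  fix S T assume S: "S \<in> link x A" and T: "T \<in> link x B" and disj: "S \<inter> T = {}"
  then obtain S' T' where S': "S' \<in> A" "x \<in> S'" "S = S' - {x}" and T': "T' \<in> B" "x \<in> T'" "T = T' - {x}"
    by (auto simp: link_def)
  have sub: "S' \<subseteq> X" "T' \<subseteq> X" "card S' = a" "card T' = b" using S' T' assms by auto
  have "finite S'" "finite T'" using sub assms(1) finite_subset by auto
  then have "card (S' \<union> T') < a + b"
    using card_Un_Int[of S' T'] S'(2) T'(2) sub by (simp add: card_gt_0_iff) (metis IntI add_gr_0 card_gt_0_iff empty_iff finite_Int less_add_same_cancel1)
  then have "card (S' \<union> T') < card X" using assms(8) by simp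
  then have "\<not> X \<subseteq> S' \<union> T'" using \<open>finite S'\<close> \<open>finite T'\<close> by (meson card_mono finite_UnI leD)
  then obtain y where y: "y \<in> X" "y \<notin> S'" "y \<notin> T'" by blast
  then have "y < x" using assms(3) S' by auto
  then have "insert y (S' - {x}) \<in> A" using assms(4) S' y by (auto simp: shifted_def)
  then show False using cross_intersectingD[OF assms(7) _ T'(1)] y disj S' T' by blast
qed

text \<open>Source of strictness in \<open>cross_shifted_bound\<close>: such a set, extended by the
  last element, avoids a member of \<open>A\<close> and hence is missing from
  \<open>B\<close>.\<close>

lemma ex_heavy_disjoint:
  assumes "finite X" "P \<subseteq> X" "E \<subseteq> X" "c \<le> b" "b + card E \<le> card X" "c \<le> card P - card E"
  shows "\<exists>T. T \<in> heavy X P b c \<and> T \<inter> E = {}"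
proof -
  have fin: "finite P" "finite E" using assms finite_subset by auto
  have "card (P - E) \<ge> card P - card E" using fin by (intro diff_card_le_card_Diff)
  then have "c \<le> card (P - E)" using assms(6) by simp
  then obtain C where C: "C \<subseteq> P - E" "card C = c" by (meson obtain_subset_with_card_n)
  have "card (X - E) = card X - card E" using assms fin by (simp add: card_Diff_subset)
  moreover have "C \<subseteq> X - E" using C assms(2) by blast
  ultimately have "\<exists>T. C \<subseteq> T \<and> T \<subseteq> X - E \<and> card T = b"
    using exists_subset_between[of C b "X - E"] C(2) assms(1,4,5) by simp
  then obtain T where T: "C \<subseteq> T" "T \<subseteq> X - E" "card T = b" by blast
  have "finite T" using T assms(1) finite_subset by blast
  then have "card C \<le> card (T \<inter> P)" using C T by (intro card_mono) auto
  then show ?thesis using T C by blast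
qed

section \<open>Shifted cross-intersecting families\<close>

lemma initial_remove_last:
  assumes "finite X" "initial P X" "x \<in> X" "\<And>y. y \<in> X - {x} \<Longrightarrow> y < x" "card P < card X"
  shows "initial P (X - {x})"
proof -
  have "x \<notin> P"
  proof
    assume xP: "x \<in> P"
    have "X \<subseteq> P"
    proof
      fix z assume z: "z \<in> X"
      show "z \<in> P"
      proof (rule ccontr)
        assume "z \<notin> P"
        then have "x < z" "z < x" using assms(2,4) xP z by (auto simp: initial_def)
        then show False by simp
      qed
    qed
    then have "card X \<le> card P"
      using assms(1,2) finite_subset[of P X] by (intro card_mono) (auto simp: initial_def)
    then show False using assms(5) by simp
  qed
  then show ?thesis using assms(2) by (auto simp: initial_def)
qed

lemma Max_facts:
  assumes "finite X" "X \<noteq> {}"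
  shows "Max X \<in> X" "\<And>y. y \<in> X - {Max X} \<Longrightarrow> y < Max X"
  using assms by (auto simp: order_less_le)

text \<open>At the base \<open>card X = a + b\<close> complementation injects \<open>A\<close> into the heavy sets outside \<open>B\<close>;
  for larger \<open>X\<close> delete the last element and treat its link separately.\<close>

lemma cross_shifted_bound:
  fixes X :: "nat set"
  assumes "finite X" "initial P X" "A \<subseteq> subsets_of_card X a" "B \<subseteq> subsets_of_card X b"
    and "shifted X A" "shifted X B" "cross_intersecting A B"
    and "a \<le> b" "a + b \<le> card X" "c \<le> card P - a" "c \<le> b - a + c'"
    and "\<forall>T\<in>A. c' \<le> card (T \<inter> P)" "\<forall>T\<in>B. c \<le> card (T \<inter> P)"
  shows "card A + card B \<le> card (heavy X P b c) \<and>
    (A \<noteq> {} \<and> a + b < card X \<and> a + c < b \<longrightarrow> card A + card B < card (heavy X P b c))"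
  using assms
proof (induction "card X" arbitrary: X P A B a b c c')
  case 0
  then have "X = {}" by simp
  have "P = {}" using \<open>X = {}\<close> 0(3) by (simp add: initial_def)
  then have ab: "a = 0" "b = 0" "c = 0" using 0(10,11) \<open>X = {}\<close> by auto
  have *: "A \<subseteq> {{}}" "B \<subseteq> {{}}" "heavy X P b c = {{}}"
    using 0(4,5) ab \<open>X = {}\<close> by auto
  have "A = {} \<or> B = {}" using *(1,2) cross_intersectingD[OF 0(8), of "{}" "{}"] by blast
  then have "card A + card B \<le> 1" using *(1,2) by (auto simp: subset_singleton_iff)
  then show ?case using * ab by simp
next
  case (Suc n)
  note fX = \<open>finite X\<close>
  have finA: "finite A" "finite B" using Suc.prems(3,4) fX finite_subset[OF _ finite_subsets_of_card'] by blast+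
  have finH: "finite (heavy X P b c)" for P b c using fX by (rule finite_subsets_of_card)
  show ?case
  proof (cases "a + b = card X")
    case True
    \<comment> \<open>Complements of \<open>a\<close>-sets are \<open>b\<close>-sets here and keep
      at least \<open>card P - a\<close> points of \<open>P\<close>; this is the origin of the
      hypothesis on \<open>c\<close>.\<close>
    have compl: "X - T \<in> heavy X P b c" if "T \<in> A" for T
    proof -
      have T: "T \<subseteq> X" "card T = a" using that Suc.prems(3) by auto
      have fT: "finite T" "finite P" using T fX Suc.prems(2) finite_subset by (auto simp: initial_def)
      have "card (X - T) = b" using T fT True by (simp add: card_Diff_subset)
      moreover have "(X - T) \<inter> P = P - T" using Suc.prems(2) by (auto simp: initial_def)
      moreover have "card (P - T) \<ge> card P - card T" using fT by (intro diff_card_le_card_Diff)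
      ultimately show ?thesis using T Suc.prems(10) by auto
    qed
    have inj: "inj_on (\<lambda>T. X - T) A" using Suc.prems(3) by (intro inj_onI) blast
    have disj: "(\<lambda>T. X - T) ` A \<inter> B = {}" using cross_intersectingD[OF Suc.prems(7)] by blast
    have "(\<lambda>T. X - T) ` A \<union> B \<subseteq> heavy X P b c" using compl Suc.prems(4,13) by auto
    then have "card ((\<lambda>T. X - T) ` A \<union> B) \<le> card (heavy X P b c)" using finH by (intro card_mono)
    then have "card A + card B \<le> card (heavy X P b c)"
      using card_Un_disjoint[OF _ _ disj] finA card_image[OF inj] by simp
    then show ?thesis using True by simp
  next
    case False
    then have less: "a + b < card X" using Suc.prems(9) by simp
    define x where "x = Max X"
    have "X \<noteq> {}" using Suc.hyps(2) by auto
    then have x: "x \<in> X" "\<And>y. y \<in> X - {x} \<Longrightarrow> y < x" using Max_facts[OF fX] unfolding x_def by auto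
    let ?X = "X - {x}"
    have cX: "n = card ?X" "finite ?X" using Suc.hyps(2) x fX by auto
    define A0 B0 where "A0 = {T \<in> A. x \<notin> T}" and "B0 = {T \<in> B. x \<notin> T}"
    have sub0: "A0 \<subseteq> subsets_of_card ?X a" "B0 \<subseteq> subsets_of_card ?X b"
      using Suc.prems(3,4) by (auto simp: A0_def B0_def)
    have sh0: "shifted ?X A0" "shifted ?X B0"
      using shifted_del Suc.prems(5,6) unfolding A0_def B0_def by auto
    have cr0: "cross_intersecting A0 B0" 
      using cross_intersectingD[OF Suc.prems(7)] unfolding cross_intersecting_def A0_def B0_def by blast
    have sub1: "link x A \<subseteq> subsets_of_card ?X (a - 1)" "link x B \<subseteq> subsets_of_card ?X (b - 1)"
      using link_subset[OF fX] Suc.prems(3,4) by auto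
    have sh1: "shifted ?X (link x A)" "shifted ?X (link x B)" using shifted_link Suc.prems(5,6) by auto
    have cr1: "cross_intersecting (link x A) (link x B)"
      using cross_intersecting_link[OF fX x Suc.prems(5,3,4,7)] less by simp
    have cardA: "card A = card A0 + card (link x A)" and cardB: "card B = card B0 + card (link x B)"
      unfolding card_link A0_def B0_def
      by (rule card_split_elem[OF finA(1)]) (rule card_split_elem[OF finA(2)])
    \<comment> \<open>Stated for arbitrary \<open>P\<close>, \<open>c\<close>, \<open>c'\<close>:
      the given segment may be all of \<open>X\<close>, and then it contains the deleted element and
      has to be replaced.\<close>
    have key: "card A + card B \<le> card (heavy X P b c) \<and>
        (A \<noteq> {} \<and> a + c < b \<longrightarrow> card A + card B < card (heavy X P b c))"
      if P: "initial P ?X" "c \<le> card P - a" "c \<le> b - a + c'"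
        "\<forall>T\<in>A. c' \<le> card (T \<inter> P)" "\<forall>T\<in>B. c \<le> card (T \<inter> P)" for P c c'
    proof -
      have xP: "x \<notin> P" "P \<subseteq> ?X" using P by (auto simp: initial_def)
      let ?V = "heavy X P b c"
      have V0: "{T \<in> ?V. x \<notin> T} = heavy ?X P b c" by auto
      have Tx: "(T - {x}) \<inter> P = T \<inter> P" for T using xP by auto
      have cardV: "card ?V = card (heavy ?X P b c) + card {T \<in> ?V. x \<in> T}"
        unfolding V0[symmetric] using finH by (rule card_split_elem)
      have link_le: "card (heavy ?X P (b - 1) c) \<le> card {T \<in> ?V. x \<in> T}" if "b \<ge> 1"
      proof (rule card_inj_on_le)
        show "inj_on (insert x) (heavy ?X P (b - 1) c)" by (intro inj_onI) (auto simp: insert_ident)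
        have "card (insert x T) = b" if "T \<subseteq> ?X" "card T = b - 1" for T
        proof -
          have "finite T" "x \<notin> T" using that fX finite_subset by auto
          then show ?thesis using that \<open>b \<ge> 1\<close> by simp
        qed
        moreover have "insert x T \<inter> P = T \<inter> P" for T using xP by auto
        ultimately show "insert x ` heavy ?X P (b - 1) c \<subseteq> {T \<in> ?V. x \<in> T}" using x by auto
        show "finite {T \<in> ?V. x \<in> T}" using fX by simp
      qed
      have part0: "card A0 + card B0 \<le> card (heavy ?X P b c)"
        using Suc.hyps(1)[OF cX(1,2) P(1) sub0 sh0 cr0 Suc.prems(8) _ P(2,3)] less P(4,5) cX Suc.hyps(2)
        by (auto simp: A0_def B0_def)
      have Bx_sub: "{T \<in> B. x \<in> T} \<subseteq> {T \<in> ?V. x \<in> T}" using Suc.prems(4) P(5) by auto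
      show ?thesis
      proof (cases "link x A = {}")
        case True
        then have noA: "A0 = A" by (auto simp: link_def A0_def)
        have "card (link x B) \<le> card {T \<in> ?V. x \<in> T}"
          unfolding card_link using Bx_sub fX by (intro card_mono) auto
        then have le: "card A + card B \<le> card ?V" using part0 cardV cardA cardB True by simp
        \<comment> \<open>No member of \<open>A\<close> contains \<open>x\<close>, so a heavy
          \<open>(b - 1)\<close>-set avoiding \<open>e\<close>, extended by \<open>x\<close>, is a
          heavy set through \<open>x\<close> that \<open>B\<close> lacks.\<close>
        have "card A + card B < card ?V" if strict: "A \<noteq> {}" "a + c < b"
        proof -
          obtain e where e: "e \<in> A" using strict by blast
          then have e': "e \<subseteq> ?X" "card e = a" using noA sub0 by auto
          have "\<exists>T. T \<in> heavy ?X P (b - 1) c \<and> T \<inter> e = {}"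
            using ex_heavy_disjoint[of ?X P e c "b - 1"] cX(2) xP e' strict P(2) less cX(1) Suc.hyps(2) by simp
          then obtain T where T: "T \<subseteq> ?X" "card T = b - 1" "c \<le> card (T \<inter> P)" "T \<inter> e = {}" by blast
          have "finite T" "x \<notin> T" using T(1) finite_subset[OF T(1) cX(2)] by auto
          then have "card (insert x T) = b" using T strict by simp
          moreover have "insert x T \<inter> P = T \<inter> P" using xP by auto
          ultimately have "insert x T \<in> {T \<in> ?V. x \<in> T}" using T x by auto
          moreover have "insert x T \<notin> B"
            using cross_intersectingD[OF Suc.prems(7) e] T(4) e' by blast
          ultimately have "{T \<in> B. x \<in> T} \<subset> {T \<in> ?V. x \<in> T}" using Bx_sub by blast
          then have "card (link x B) < card {T \<in> ?V. x \<in> T}"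
            unfolding card_link using fX by (intro psubset_card_mono) auto
          then show ?thesis using part0 cardV cardA cardB True by simp
        qed
        then show ?thesis using le by blast
      next
        case False
        then obtain e where "e \<in> A" "x \<in> e" by (auto simp: link_def)
        moreover have "e \<subseteq> X" "card e = a" using \<open>e \<in> A\<close> Suc.prems(3) by auto
        ultimately have a1: "a \<ge> 1"
          using fX finite_subset by (metis One_nat_def Suc_leI card_gt_0_iff empty_iff)
        then have b1: "b \<ge> 1" using Suc.prems(8) by simp
        have hv: "\<forall>T\<in>link x A. c' \<le> card (T \<inter> P)" "\<forall>T\<in>link x B. c \<le> card (T \<inter> P)"
          using P(4,5) Tx by (auto simp: link_def)
        have ineq: "a - 1 \<le> b - 1" "a - 1 + (b - 1) \<le> card ?X" "a - 1 + (b - 1) < card ?X" "c \<le> card P - (a - 1)"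
          "c \<le> b - 1 - (a - 1) + c'"
          using a1 b1 Suc.prems(8) less P(2,3) cX(1) Suc.hyps(2) by auto
        note IH = Suc.hyps(1)[OF cX(1,2) P(1) sub1 sh1 cr1 ineq(1,2,4,5) hv]
        have le1: "card (link x A) + card (link x B) \<le> card {T \<in> ?V. x \<in> T}"
          using IH link_le[OF b1] by linarith
        have "card (link x A) + card (link x B) < card {T \<in> ?V. x \<in> T}" if "a + c < b"
        proof -
          have "a - 1 + c < b - 1" using a1 that by linarith
          then show ?thesis using IH link_le[OF b1] False ineq(3) by linarith
        qed
        then show ?thesis using le1 part0 cardV cardA cardB by linarith
      qed
    qed
    show ?thesis
    proof (cases "card P < card X")
      case True
      have "initial P ?X" using initial_remove_last[OF fX Suc.prems(2) x True] .
      from key[OF this Suc.prems(10-13)] show ?thesis using less by simp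
    next
      case False
      then have PX: "P = X"
        using Suc.prems(2) fX by (meson card_subset_eq initial_def card_mono le_antisym linorder_not_less)
      show ?thesis
      proof (cases "A = {}")
        case True
        have "B \<subseteq> heavy X P b c" using Suc.prems(4,13) by auto
        then have "card B \<le> card (heavy X P b c)" using finH by (intro card_mono)
        then show ?thesis using True by simp
      next
        case False
        then obtain e where e: "e \<in> A" by blast
        then have "e \<subseteq> X" "card e = a" using Suc.prems(3) by auto
        \<comment> \<open>With \<open>P = X\<close>, the hypothesis
          \<open>c \<le> b - a + c'\<close> yields \<open>c \<le> b\<close>, so every
          \<open>b\<close>-set is heavy and the segment \<open>{}\<close> with threshold
          \<open>0\<close> describes the same sets.\<close>
        then have "c' \<le> a" using Suc.prems(12) e PX by (auto simp: Int_absorb2)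
        then have "c \<le> b" using Suc.prems(8,11) by simp
        then have V: "heavy X P b c = subsets_of_card X b" using PX by (auto simp: Int_absorb2)
        have "initial {} ?X" by (simp add: initial_def)
        from key[OF this, of 0 0] show ?thesis using less V by simp
      qed
    qed
  qed
qed

text \<open>The size \<open>card P = k + c - 1\<close> is what \<open>cross_shifted_bound\<close>
  asks for links, whose members have \<open>k - 1\<close> elements; for \<open>c \<ge> 1\<close> it
  is one too small for the families themselves, so elements are peeled off \<open>X\<close> down to
  \<open>2 * k\<close>. The condition \<open>card P \<le> 2 * k\<close> keeps the peeled element
  outside \<open>P\<close>. The uses are \<open>c = 1\<close> and \<open>c = 2\<close>.\<close>

lemma cross_shifted_sum:
  fixes X :: "nat set" and f :: "nat \<Rightarrow> int"
  assumes "finite X" "initial P X" "A \<subseteq> subsets_of_card X k" "B \<subseteq> subsets_of_card X k"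
    and "shifted X A" "shifted X B" "cross_intersecting A B" "2 * k \<le> card X"
    and "\<forall>T\<in>A. c \<le> card (T \<inter> P)" "\<forall>T\<in>B. c \<le> card (T \<inter> P)"
    and P: "card P + 1 = k + c" "card P \<le> 2 * k" "k \<ge> 1"
    and f: "int ((2 * k) choose k) \<le> f (2 * k)"
      "\<And>Y. finite Y \<Longrightarrow> P \<subseteq> Y \<Longrightarrow> 2 * k \<le> card Y \<Longrightarrow>
        f (card Y) + int (card (heavy Y P (k - 1) c)) \<le> f (card Y + 1)"
  shows "int (card A + card B) \<le> f (card X)"
  using assms(1-10)
proof (induction "card X" arbitrary: X A B rule: less_induct)
  case less
  note fX = \<open>finite X\<close>
  have finA: "finite A" "finite B" using less.prems(3,4) fX finite_subset[OF _ finite_subsets_of_card'] by blast+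
  show ?case
  proof (cases "card X = 2 * k")
    case True
    have "initial {} X" by (simp add: initial_def)
    from cross_shifted_bound[OF fX this less.prems(3-7), of 0 0]
    have "card A + card B \<le> card (subsets_of_card X k)" using less.prems(8) by simp
    also have "\<dots> = (2 * k) choose k" using n_subsets[OF fX] True by simp
    finally show ?thesis using f(1) True by simp
  next
    case False
    then have N: "2 * k < card X" using less.prems(8) by simp
    define x where "x = Max X"
    have "X \<noteq> {}" using N by auto
    then have x: "x \<in> X" "\<And>y. y \<in> X - {x} \<Longrightarrow> y < x" using Max_facts[OF fX] unfolding x_def by auto
    let ?X = "X - {x}"
    have cX: "card X = card ?X + 1" "finite ?X" using x fX N by auto
    have P': "initial P ?X" using initial_remove_last[OF fX less.prems(2) x] N P by simp
    then have xP: "x \<notin> P" "P \<subseteq> ?X" by (auto simp: initial_def)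
    have Tx: "(T - {x}) \<inter> P = T \<inter> P" for T using xP by auto
    have sub0: "{T \<in> A. x \<notin> T} \<subseteq> subsets_of_card ?X k" "{T \<in> B. x \<notin> T} \<subseteq> subsets_of_card ?X k"
      using less.prems(3,4) by auto
    have cr0: "cross_intersecting {T \<in> A. x \<notin> T} {T \<in> B. x \<notin> T}"
      using cross_intersectingD[OF less.prems(7)] unfolding cross_intersecting_def by blast
    have sub1: "link x A \<subseteq> subsets_of_card ?X (k - 1)" "link x B \<subseteq> subsets_of_card ?X (k - 1)"
      using link_subset[OF fX] less.prems(3,4) by auto
    have sh1: "shifted ?X (link x A)" "shifted ?X (link x B)" using shifted_link less.prems(5,6) by auto
    have cr1: "cross_intersecting (link x A) (link x B)"
      using cross_intersecting_link[OF fX x less.prems(5,3,4,7)] N by simp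
    have hv: "\<forall>T\<in>link x A. c \<le> card (T \<inter> P)" "\<forall>T\<in>link x B. c \<le> card (T \<inter> P)"
      using less.prems(9,10) Tx by (auto simp: link_def)
    have "int (card {T \<in> A. x \<notin> T} + card {T \<in> B. x \<notin> T}) \<le> f (card ?X)"
      using less.hyps[OF _ cX(2) P' sub0 shifted_del shifted_del cr0] less.prems(5,6,9,10) cX(1) N by simp
    moreover have "card (link x A) + card (link x B) \<le> card (heavy ?X P (k - 1) c)"
      using cross_shifted_bound[OF cX(2) P' sub1 sh1 cr1 _ _ _ _ hv] P N cX(1) by simp
    moreover have "card A = card {T \<in> A. x \<notin> T} + card (link x A)" "card B = card {T \<in> B. x \<notin> T} + card (link x B)"
      unfolding card_link by (rule card_split_elem[OF finA(1)]) (rule card_split_elem[OF finA(2)])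
    moreover have "f (card ?X) + int (card (heavy ?X P (k - 1) c)) \<le> f (card X)"
      using f(2)[OF cX(2) xP(2)] N unfolding cX(1) by simp
    ultimately show ?thesis by linarith
  qed
qed

lemma card_heavy_one:
  assumes "finite X" "P \<subseteq> X"
  shows "int (card (heavy X P b 1)) = int (card X choose b) - int ((card X - card P) choose b)"
proof -
  have "finite P" using assms finite_subset by blast
  then have "1 \<le> card (T \<inter> P) \<longleftrightarrow> T \<inter> P \<noteq> {}" for T by (auto simp: Suc_le_eq card_gt_0_iff)
  then have "heavy X P b 1 = {T. T \<subseteq> X \<and> card T = b \<and> T \<inter> P \<noteq> {}}" by auto
  then show ?thesis using card_subsets_meeting[OF assms(1), of b P] assms(2) by (simp add: Int_absorb2)
qed

lemma shift_nonempty_iff [simp]: "shift i j F = {} \<longleftrightarrow> F = {}"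
  by (simp add: shift_def)

text \<open>A single \<open>k\<close>-set against all \<open>k\<close>-sets meeting it attains the
  bound. Once shifted, both families contain the set \<open>P\<close> of the first \<open>k\<close>
  elements, so all members meet \<open>P\<close> and \<open>cross_shifted_sum\<close> applies with
  \<open>c = 1\<close>.\<close>

theorem card_cross_intersecting_nonempty:
  fixes X :: "nat set"
  assumes "finite X" "A \<subseteq> subsets_of_card X k" "B \<subseteq> subsets_of_card X k"
    and "cross_intersecting A B" "A \<noteq> {}" "B \<noteq> {}" "k \<ge> 1" "2 * k \<le> card X"
  shows "int (card A + card B) \<le> 1 + int (card X choose k) - int ((card X - k) choose k)"
proof -
  have "A \<subseteq> Pow X" "B \<subseteq> Pow X" using assms by auto
  from assms(1) this assms(2-6) show ?thesis
  proof (induction A B rule: shift_induct)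
    case (shifted F G)
    obtain P where P: "initial P X" "card P = k"
      using initial_exists[OF assms(1), of k] assms(8) by auto
    have fP: "P \<subseteq> X" "finite P" using P assms(1) finite_subset by (auto simp: initial_def)
    have mem: "P \<in> F" if F: "shifted X F" "F \<subseteq> subsets_of_card X k" "F \<noteq> {}" for F
    proof -
      obtain T where T: "T \<in> F" using F(3) by blast
      moreover have "T \<subseteq> X" "card T = k" using T F(2) by auto
      ultimately obtain T' where "T' \<in> F" "T' \<subseteq> P"
        using shifted_push[OF assms(1) F(1) P(1) order_refl T] P(2) by auto
      then have "T' = P" using F(2) fP P(2) card_subset_eq[of P T'] by auto
      then show ?thesis using \<open>T' \<in> F\<close> by simp
    qed
    have PF: "P \<in> F" "P \<in> G" using mem shifted.hyps shifted.prems by auto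
    have meet: "1 \<le> card (T \<inter> P)" if "T \<inter> P \<noteq> {}" for T
      using that fP by (simp add: Suc_le_eq card_gt_0_iff)
    define f where "f N = 1 + int (N choose k) - int ((N - k) choose k)" for N
    have "int (card F + card G) \<le> f (card X)"
    proof (rule cross_shifted_sum[where c = 1, OF assms(1) P(1) shifted.prems(1,2) shifted.hyps(3,4) shifted.prems(3) assms(8)])
      show "\<forall>T\<in>F. 1 \<le> card (T \<inter> P)"
        using cross_intersectingD[OF shifted.prems(3) _ PF(2)] meet by blast
      show "\<forall>T\<in>G. 1 \<le> card (T \<inter> P)"
        using cross_intersectingD[OF shifted.prems(3) PF(1)] meet by (metis Int_commute)
      show "int ((2 * k) choose k) \<le> f (2 * k)" by (simp add: f_def mult_2)
      fix Y assume Y: "finite Y" "P \<subseteq> Y" "2 * k \<le> card Y"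
      have "card Y + 1 - k = Suc (card Y - k)" "card Y - k \<ge> k" using Y(3) by auto
      then have "f (card Y + 1) = f (card Y) + (int (card Y choose (k - 1)) - int ((card Y - k) choose (k - 1)))"
        unfolding f_def using assms(7) by (cases k) auto
      then show "f (card Y) + int (card (heavy Y P (k - 1) 1)) \<le> f (card Y + 1)"
        using card_heavy_one[OF Y(1,2), of "k - 1"] P(2) by simp
    qed (use P assms(7) in auto)
    then show ?case by (simp add: f_def)
  next
    case (step F G i j)
    then show ?case
      using shift_subsets_of_card[OF assms(1)] cross_intersecting_shift by simp
  qed
qed

lemma shifted_layer:
  assumes "finite X" "H \<subseteq> Pow X" "shifted X H"
  shows "shifted X {T \<in> H. card T = a}"
  unfolding shifted_def
proof (intro ballI impI)
  fix T j i assume T: "T \<in> {T \<in> H. card T = a}" "j \<in> T" "i \<in> X" "i < j \<and> i \<notin> T"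
  have "finite T" using T assms(1,2) finite_subset by blast
  then have "card (insert i (T - {j})) = card T" using card_Suc_Diff1[of T j] T by simp
  then show "insert i (T - {j}) \<in> {T \<in> H. card T = a}" using T assms(3) by (simp add: shifted_def)
qed

text \<open>After shifting, a member of \<open>H\<close> of whatever size lies within the first
  \<open>q\<close> elements \<open>P\<close>, so all of \<open>B\<close> meets \<open>P\<close> and
  \<open>cross_shifted_bound\<close> applies with \<open>c = 1\<close>. The bound counts the
  \<open>b\<close>-sets meeting a \<open>q\<close>-set. The other layers of \<open>H\<close>
  constrain \<open>B\<close> even when the counted layer is empty.\<close>

lemma card_layer_cross_nonempty:
  fixes X :: "nat set"
  assumes "finite X" "H \<subseteq> Pow X" "B \<subseteq> subsets_of_card X b"
    and "cross_intersecting H B" "H \<noteq> {}" "\<forall>T\<in>H. card T \<le> q"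
    and num: "a + 1 \<le> q" "a + 1 \<le> b" "a + b \<le> card X" "q \<le> card X"
  shows "int (card {T \<in> H. card T = a} + card B) \<le> int (card X choose b) - int ((card X - q) choose b) \<and>
    (0 < card {T \<in> H. card T = a} \<and> a + b < card X \<and> a + 2 \<le> b \<longrightarrow>
      int (card {T \<in> H. card T = a} + card B) < int (card X choose b) - int ((card X - q) choose b))"
proof -
  have "B \<subseteq> Pow X" using assms by auto
  from assms(1,2) this assms(3-6) show ?thesis
  proof (induction H B rule: shift_induct)
    case (shifted H B)
    obtain P where P: "initial P X" "card P = q"
      using initial_exists[OF assms(1) num(4)] by auto
    have fP: "P \<subseteq> X" "finite P" using P assms(1) finite_subset by (auto simp: initial_def)
    obtain T where T: "T \<in> H" using shifted.prems by blast
    then obtain S where S: "S \<in> H" "S \<subseteq> P"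
      using shifted_push[OF assms(1) shifted.hyps(3) P(1) order_refl T] shifted P(2) by auto
    have "1 \<le> card (T \<inter> P)" if "T \<in> B" for T
    proof -
      have "T \<inter> P \<noteq> {}" using cross_intersectingD[OF shifted.prems(2) S(1) that] S(2) by blast
      then show ?thesis using fP by (simp add: Suc_le_eq card_gt_0_iff)
    qed
    moreover have "shifted X {T \<in> H. card T = a}" by (rule shifted_layer[OF assms(1) shifted.hyps(1,3)])
    moreover have "{T \<in> H. card T = a} \<subseteq> subsets_of_card X a" using shifted.hyps(1) by auto
    moreover have "cross_intersecting {T \<in> H. card T = a} B"
      using shifted.prems(2) by (simp add: cross_intersecting_def)
    ultimately have "card {T \<in> H. card T = a} + card B \<le> card (heavy X P b 1) \<and>
      ({T \<in> H. card T = a} \<noteq> {} \<and> a + b < card X \<and> a + 1 < b \<longrightarrow>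
        card {T \<in> H. card T = a} + card B < card (heavy X P b 1))"
      using cross_shifted_bound[OF assms(1) P(1) _ shifted.prems(1) _ shifted.hyps(4), of "{T \<in> H. card T = a}" a 1 0]
        num P(2) by simp
    then show ?case
      using card_heavy_one[OF assms(1) fP(1), of b] P(2) by (auto simp: card_gt_0_iff)
  next
    case (step H B i j)
    have "card T \<le> q" if T: "T \<in> shift i j H" for T
    proof -
      obtain S where S: "S \<in> H" "T = shift_set i j H S" using T unfolding shift_def by blast
      then have "finite S" using step.hyps(1) assms(1) finite_subset by blast
      then show ?thesis using S step.prems(4) card_shift_set by simp
    qed
    then show ?case
      using step.IH shift_subsets_of_card[OF assms(1) step.prems(1) step.hyps(3)]
        cross_intersecting_shift[OF step.prems(2)] step.prems(3)
      by (simp add: card_shift_of_card[OF assms(1) step.hyps(1)])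
  qed
qed

section \<open>Cross-intersection with a family without common element\<close>

text \<open>Non-triviality relative to a ground set: it survives enlarging the family and passes
  directly to the sets \<open>T - {i, j}\<close> over \<open>X - {i, j}\<close>.\<close>

definition centerless :: "'a set \<Rightarrow> 'a set set \<Rightarrow> bool" where
  "centerless X F \<longleftrightarrow> (\<forall>x\<in>X. \<exists>T\<in>F. x \<notin> T)"

text \<open>Any member of \<open>H\<close>, enlarged to a \<open>q\<close>-set, can serve as
  \<open>Q\<close>, and for each of its points some member avoids that point. This settles the cases
  in which the counted layer is empty.\<close>

lemma card_transversals_centerless:
  assumes "finite X" "H \<subseteq> Pow X" "centerless X H" "\<forall>T\<in>H. card T \<le> q" "X \<noteq> {}" "2 * q \<le> card X" "b \<ge> 1"
    and "B \<subseteq> subsets_of_card X b" "cross_intersecting H B"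
  shows "int (card B) \<le> two_set_count (card X) q q b"
proof -
  obtain T where T: "T \<in> H" using assms(3,5) by (auto simp: centerless_def)
  then have "T \<subseteq> X" "card T \<le> q" using assms(2,4) by auto
  then obtain Q where Q: "T \<subseteq> Q" "Q \<subseteq> X" "card Q = q"
    using exists_subset_between[of T q X] assms(1,6) by auto
  let ?S = "{T. T \<subseteq> X \<and> card T = b \<and> T \<inter> Q \<noteq> {} \<and> (\<forall>e\<in>H. T \<inter> e \<noteq> {})}"
  have "B \<subseteq> ?S"
  proof
    fix S assume S: "S \<in> B"
    then have "\<forall>e\<in>H. e \<inter> S \<noteq> {}" using cross_intersectingD[OF assms(9)] by blast
    then have "T \<inter> S \<noteq> {}" "\<forall>e\<in>H. S \<inter> e \<noteq> {}" using T by (auto simp: Int_commute)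
    then show "S \<in> ?S" using S Q(1) assms(8) by blast
  qed
  then have "card B \<le> card ?S" using assms(1) by (intro card_mono) auto
  moreover have "int (card ?S) \<le> two_set_count (card X) q q b"
  proof (rule card_transversals_le[OF assms(1) Q(2,3) _ assms(7)])
    fix x assume "x \<in> Q"
    then obtain e where "e \<in> H" "x \<notin> e" using assms(3) Q(2) by (auto simp: centerless_def)
    moreover have "e \<inter> X = e" using \<open>e \<in> H\<close> assms(2) by blast
    ultimately show "\<exists>e\<in>H. x \<notin> e \<and> card (e \<inter> X) \<le> q" using assms(4) by auto
  qed (use assms(6) in simp)
  ultimately show ?thesis by linarith
qed

text \<open>The sets meeting a \<open>(q + 1)\<close>-set \<open>P\<close> twice are the transversals of all \<open>q\<close>-subsets of \<open>P\<close>.\<close>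

lemma card_heavy_two:
  assumes "finite X" "P \<subseteq> X" "card P = q + 1" "q \<ge> 1" "2 * q \<le> card X" "b \<ge> 1"
  shows "int (card (heavy X P b 2)) \<le> two_set_count (card X) q q b"
    and "\<lbrakk>q \<ge> 2; b \<ge> 2; q + b \<le> card X\<rbrakk> \<Longrightarrow> int (card (heavy X P b 2)) < two_set_count (card X) q q b"
proof -
  have fP: "finite P" using assms finite_subset by blast
  let ?H = "(\<lambda>x. P - {x}) ` P"
  obtain p where p: "p \<in> P" using assms(3) by fastforce
  let ?Q = "P - {p}"
  have cQ: "card ?Q = q" "?Q \<subseteq> X" using p assms by auto
  have sz: "card ((P - {x}) \<inter> X) = q" if "x \<in> P" for x
  proof -
    have "(P - {x}) \<inter> X = P - {x}" using assms(2) by auto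
    then show ?thesis using that assms(3) by simp
  qed
  let ?S = "{T. T \<subseteq> X \<and> card T = b \<and> T \<inter> ?Q \<noteq> {} \<and> (\<forall>e\<in>?H. T \<inter> e \<noteq> {})}"
  have "heavy X P b 2 \<subseteq> ?S"
  proof
    fix T assume T: "T \<in> heavy X P b 2"
    have "T \<inter> (P - {x}) \<noteq> {}" for x
    proof
      assume "T \<inter> (P - {x}) = {}"
      then have "T \<inter> P \<subseteq> {x}" by auto
      then have "card (T \<inter> P) \<le> card {x}" by (intro card_mono) auto
      then show False using T by simp
    qed
    then show "T \<in> ?S" using T by auto
  qed
  then have le: "card (heavy X P b 2) \<le> card ?S" using assms(1) by (intro card_mono) auto
  have cov: "\<exists>e\<in>?H. x \<notin> e \<and> card (e \<inter> X) \<le> q" if "x \<in> ?Q" for x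
    using that sz[of x] by (intro bexI[of _ "P - {x}"]) auto
  have "int (card ?S) \<le> two_set_count (card X) q q b"
    using cov assms by (intro card_transversals_le[OF assms(1) cQ(2,1)]) auto
  then show "int (card (heavy X P b 2)) \<le> two_set_count (card X) q q b" using le by linarith
  assume strict: "q \<ge> 2" "b \<ge> 2" "q + b \<le> card X"
  have "finite ?Q" using fP by simp
  have "\<exists>x y. x \<in> ?Q \<and> y \<in> ?Q \<and> x \<noteq> y"
  proof (rule ccontr)
    assume "\<not> ?thesis"
    then have "card ?Q \<le> 1" using \<open>finite ?Q\<close> card_le_Suc0_iff_eq[of ?Q] by auto
    then show False using cQ strict by simp
  qed
  then obtain x y where xy: "x \<in> ?Q" "y \<in> ?Q" "x \<noteq> y" by blast
  \<comment> \<open>The set \<open>P - {x}\<close> misses \<open>x\<close> but contains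
    \<open>y\<close>, which is the situation of \<open>card_transversals_less\<close>.\<close>
  have "int (card ?S) < two_set_count (card X) q q b"
  proof (rule card_transversals_less[OF assms(1) cQ(2,1) _ strict(2,3) cov xy(1,2)])
    show "P - {x} \<in> ?H" "x \<notin> P - {x}" "y \<in> P - {x}" using xy by auto
    show "card ((P - {x}) \<inter> X) \<le> q" using sz xy by auto
  qed (use assms(5) in auto)
  then show "int (card (heavy X P b 2)) < two_set_count (card X) q q b" using le by linarith
qed

text \<open>If \<open>S\<close> met \<open>P\<close> only within \<open>{x}\<close>, a member of
  \<open>H\<close> missing \<open>x\<close> could be pushed into \<open>P - {x}\<close>, which has
  exactly \<open>q\<close> elements, and would then miss \<open>S\<close>.\<close>

lemma heavy_of_shifted:
  assumes "finite X" "shifted X H" "H \<subseteq> Pow X" "initial P X" "card P = q + 1"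
    and "\<forall>T\<in>H. card T \<le> q" "centerless X H" "cross_intersecting H B" "S \<in> B"
  shows "2 \<le> card (S \<inter> P)"
proof (rule ccontr)
  assume "\<not> 2 \<le> card (S \<inter> P)"
  have PX: "P \<subseteq> X" using assms(4) by (simp add: initial_def)
  then have fP: "finite P" using assms(1) finite_subset by blast
  have "\<exists>x\<in>P. S \<inter> P \<subseteq> {x}"
  proof (cases "S \<inter> P = {}")
    case True
    have "P \<noteq> {}" using assms(5) by auto
    then show ?thesis using True by auto
  next
    case False
    then obtain x where "x \<in> S \<inter> P" by blast
    moreover have "card (S \<inter> P) \<le> Suc 0" using \<open>\<not> 2 \<le> card (S \<inter> P)\<close> by simp
    ultimately have "S \<inter> P \<subseteq> {x}" using card_le_Suc0_iff_eq[of "S \<inter> P"] fP by auto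
    then show ?thesis using \<open>x \<in> S \<inter> P\<close> by auto
  qed
  then obtain x where x: "x \<in> P" "S \<inter> P \<subseteq> {x}" by blast
  then have "x \<in> X" using PX by blast
  then obtain T where T: "T \<in> H" "x \<notin> T" using assms(7) unfolding centerless_def by blast
  have "card (P - {x}) = q" using x fP assms(5) by simp
  then obtain T' where "T' \<in> H" "T' \<subseteq> P - {x}"
    using shifted_push[OF assms(1,2,4), of "P - {x}" T] T assms(3,6) by auto
  then show False using cross_intersectingD[OF assms(8) _ assms(9)] x(2) by blast
qed

section \<open>Splitting a family along its traces on two points\<close>

definition trace :: "'a set \<Rightarrow> 'a set \<Rightarrow> 'a set set \<Rightarrow> 'a set set" where
  "trace U S F = (\<lambda>T. T - U) ` {T \<in> F. T \<inter> U = S}"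

lemma card_trace: "card (trace U S F) = card {T \<in> F. T \<inter> U = S}"
  unfolding trace_def by (intro card_image inj_onI) blast

lemma card_eq_sum_traces:
  assumes "finite F" "i \<noteq> j"
  shows "card F = card (trace {i, j} {} F) + card (trace {i, j} {i} F)
    + card (trace {i, j} {j} F) + card (trace {i, j} {i, j} F)"
proof -
  have split: "card G = card {T \<in> G. i \<notin> T \<and> j \<notin> T} + card {T \<in> G. i \<notin> T \<and> j \<in> T}
    + (card {T \<in> G. i \<in> T \<and> j \<notin> T} + card {T \<in> G. i \<in> T \<and> j \<in> T})" if "finite G" for G
    using card_split_elem[OF that, of i] card_split_elem[of "{T \<in> G. i \<notin> T}" j]
      card_split_elem[of "{T \<in> G. i \<in> T}" j] that by (simp add: conj_ac)
  have *: "{T \<in> F. T \<inter> {i, j} = {}} = {T \<in> F. i \<notin> T \<and> j \<notin> T}"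
    "{T \<in> F. T \<inter> {i, j} = {i}} = {T \<in> F. i \<in> T \<and> j \<notin> T}"
    "{T \<in> F. T \<inter> {i, j} = {j}} = {T \<in> F. i \<notin> T \<and> j \<in> T}"
    "{T \<in> F. T \<inter> {i, j} = {i, j}} = {T \<in> F. i \<in> T \<and> j \<in> T}"
    using assms(2) by auto
  show ?thesis unfolding card_trace * using split[OF assms(1)] by simp
qed

lemma card_minus_trace:
  assumes "finite U" "T \<inter> U = S"
  shows "card (T - U) = card T - card S"
  using assms card_Diff_subset_Int[of T U] by auto

lemma trace_subsets_of_card:
  assumes "finite U" "F \<subseteq> subsets_of_card X k"
  shows "trace U S F \<subseteq> subsets_of_card (X - U) (k - card S)"
  using assms card_minus_trace[OF assms(1)] by (fastforce simp: trace_def)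

lemma cross_intersecting_trace:
  assumes "cross_intersecting F G" "S \<inter> S' = {}"
  shows "cross_intersecting (trace U S F) (trace U S' G)"
  unfolding cross_intersecting_def trace_def
proof (clarsimp)
  fix T T' assume "T \<in> F" "S = T \<inter> U" "T' \<in> G" "S' = T' \<inter> U" "(T - U) \<inter> (T' - U) = {}"
  then show False using cross_intersectingD[OF assms(1), of T T'] assms(2) by blast
qed

text \<open>If a shift destroys centerlessness, then every member of \<open>H\<close> meets \<open>{i, j}\<close>, and the claim
  for \<open>X\<close> splits along the traces on \<open>{i, j}\<close> into claims for \<open>X - {i, j}\<close>.\<close>

theorem card_layer_cross_centerless:
  fixes X :: "nat set"
  assumes "finite X" "H \<subseteq> Pow X" "B \<subseteq> subsets_of_card X b"
    and "cross_intersecting H B" "centerless X H" "\<forall>T\<in>H. card T \<le> q"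
    and "a + 1 \<le> q" "a + 2 \<le> b" "a + b \<le> card X" "2 * q \<le> card X"
  shows "int (card {T \<in> H. card T = a} + card B) \<le> two_set_count (card X) q q b \<and>
    (0 < card {T \<in> H. card T = a} \<and> a + b < card X \<and> (a + 3 \<le> b \<or> 2 \<le> q \<and> q + b \<le> card X) \<longrightarrow>
      int (card {T \<in> H. card T = a} + card B) < two_set_count (card X) q q b)"
  using assms
proof (induction q arbitrary: X H B a)
  case 0
  then show ?case by simp
next
  case (Suc q X H B a)
  note fX = \<open>finite X\<close>
  note num = Suc.prems(7-10)
  have XX: "X \<noteq> {}" using num by auto
  have "B \<subseteq> Pow X" using Suc.prems(3) by auto
  from fX Suc.prems(2) this Suc.prems(3-6) show ?case
  proof (induction H B rule: shift_induct)
    case (shifted H B)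
    obtain P where P: "initial P X" "card P = Suc q + 1"
      using initial_exists[OF fX, of "Suc q + 1"] num by auto
    then have PX: "P \<subseteq> X" by (simp add: initial_def)
    have "\<forall>T\<in>B. 2 \<le> card (T \<inter> P)"
      using heavy_of_shifted[OF fX shifted.hyps(3,1) P shifted.prems(4,3,2)] by blast
    moreover have "cross_intersecting {T \<in> H. card T = a} B"
      using shifted.prems(2) by (simp add: cross_intersecting_def)
    moreover have "{T \<in> H. card T = a} \<subseteq> subsets_of_card X a" using shifted.hyps(1) by auto
    ultimately have le: "card {T \<in> H. card T = a} + card B \<le> card (heavy X P b 2)"
      and less: "{T \<in> H. card T = a} \<noteq> {} \<and> a + b < card X \<and> a + 2 < b \<longrightarrow>
        card {T \<in> H. card T = a} + card B < card (heavy X P b 2)"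
      using cross_shifted_bound[OF fX P(1) _ shifted.prems(1) shifted_layer[OF fX shifted.hyps(1,3)] shifted.hyps(4), of a a 2 0]
        num P(2) by simp_all
    \<comment> \<open>Strictness has two sources: \<open>cross_shifted_bound\<close> with
      \<open>c = 2\<close> if \<open>a + 3 \<le> b\<close>, and otherwise the heavy sets being fewer
      than the transversals of two disjoint sets.\<close>
    have "int (card (heavy X P b 2)) \<le> two_set_count (card X) (Suc q) (Suc q) b"
      "2 \<le> Suc q \<Longrightarrow> Suc q + b \<le> card X \<Longrightarrow> int (card (heavy X P b 2)) < two_set_count (card X) (Suc q) (Suc q) b"
      using card_heavy_two[OF fX PX P(2), of b] num by simp_all
    then show ?case using le less by (fastforce simp: card_gt_0_iff)
  next
    case (step H B i j)
    show ?case
    proof (cases "centerless X (shift i j H)")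
      case True
      have "card T \<le> Suc q" if T: "T \<in> shift i j H" for T
      proof -
        obtain S where S: "S \<in> H" "T = shift_set i j H S" using T unfolding shift_def by blast
        then have "finite S" using step.hyps(1) fX finite_subset by blast
        then show ?thesis using S step.prems(4) card_shift_set by simp
      qed
      then show ?thesis
        using step.IH[OF shift_subsets_of_card[OF fX step.prems(1) step.hyps(3)]
          cross_intersecting_shift[OF step.prems(2)] True]
        by (simp add: card_shift_of_card[OF fX step.hyps(1)])
    next
      case False
      then obtain y where y: "y \<in> X" "\<forall>T\<in>shift i j H. y \<in> T" by (auto simp: centerless_def)
      have "\<exists>T\<in>H. y \<notin> T" using step.prems(3) y by (auto simp: centerless_def)
      then have cover: "i \<in> T \<or> j \<in> T" if "T \<in> H" for T
        using shift_common_element(1)[OF y(1) _ y(2) that] by blast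
      define L where "L = {T \<in> H. card T = a}"
      show ?thesis unfolding L_def[symmetric]
      proof (cases "card L = 0")
        case True
        then show "int (card L + card B) \<le> two_set_count (card X) (Suc q) (Suc q) b \<and>
          (0 < card L \<and> a + b < card X \<and> (a + 3 \<le> b \<or> 2 \<le> Suc q \<and> Suc q + b \<le> card X) \<longrightarrow>
          int (card L + card B) < two_set_count (card X) (Suc q) (Suc q) b)"
          using card_transversals_centerless[OF fX step.hyps(1) step.prems(3,4) XX _ _ step.prems(1,2)] num by simp
      next
        case False
        have fin: "finite H" "finite B" using step.hyps fX finite_subset[of _ "Pow X"] by auto
        have finL: "finite L" using fin by (simp add: L_def)
        have LH: "L \<subseteq> H" by (auto simp: L_def)
        let ?U = "{i, j}"
        let ?X = "X - ?U"
        have ij: "i \<noteq> j" using step.hyps by simp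
        have cX: "card ?X = card X - 2" "finite ?X" using step.hyps ij fX by auto
        obtain T0 where T0: "T0 \<in> L" using False by (metis card.empty ex_in_conv)
        then have "T0 \<noteq> {}" "finite T0" "card T0 = a"
          using cover step.hyps(1) finite_subset[OF _ fX] by (auto simp: L_def)
        then have a1: "a \<ge> 1" by (metis One_nat_def Suc_leI card_gt_0_iff)
        have q1: "q \<ge> 1" and b3: "b \<ge> 3" and N4: "card X \<ge> 4" using a1 num by auto
        have Lempty: "trace ?U {} L = {}" using cover LH by (auto simp: trace_def)
        have part: "int (card (trace ?U {u} L) + card (trace ?U {v} B))
            \<le> int ((card X - 2) choose (b - 1)) - int ((card X - 2 - q) choose (b - 1)) \<and>
            (0 < card (trace ?U {u} L) \<and> a + b < card X \<longrightarrow> int (card (trace ?U {u} L) + card (trace ?U {v} B))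
            < int ((card X - 2) choose (b - 1)) - int ((card X - 2 - q) choose (b - 1)))"
          if uv: "u \<in> ?U" "v \<in> ?U" "u \<noteq> v" for u v
        proof -
          have UV: "?U = {u, v}" using uv by auto
          \<comment> \<open>The witness is sought in all of \<open>H\<close>: the trace of
            \<open>L\<close> at \<open>u\<close> may be empty, that of \<open>H\<close> is
            not.\<close>
          obtain T where T: "T \<in> H" "v \<notin> T"
            using step.prems(3) step.hyps(3,4) uv by (auto simp: centerless_def)
          then have "T \<inter> ?U = {u}" using cover[OF T(1)] UV uv by auto
          then have ne: "trace ?U {u} H \<noteq> {}" using T by (auto simp: trace_def)
          have sub: "trace ?U {u} H \<subseteq> Pow ?X" using step.hyps(1) by (auto simp: trace_def)
          have subB: "trace ?U {v} B \<subseteq> subsets_of_card ?X (b - 1)"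
            using trace_subsets_of_card[OF _ step.prems(1), of ?U "{v}"] by simp
          have sz: "\<forall>T\<in>trace ?U {u} H. card T \<le> q"
            using step.prems(4) card_minus_trace[of ?U _ "{u}"] by (fastforce simp: trace_def)
          have "trace ?U {u} L \<subseteq> {T \<in> trace ?U {u} H. card T = a - 1}"
            using card_minus_trace[of ?U _ "{u}"] by (fastforce simp: trace_def L_def)
          moreover have "finite (trace ?U {u} H)" using fin by (simp add: trace_def)
          ultimately have le: "card (trace ?U {u} L) \<le> card {T \<in> trace ?U {u} H. card T = a - 1}"
            by (intro card_mono) auto
          have n: "a - 1 + 1 \<le> q" "a - 1 + 1 \<le> b - 1" "a - 1 + (b - 1) \<le> card ?X" "q \<le> card ?X"
            "a - 1 + 2 \<le> b - 1" "a + b < card X \<Longrightarrow> a - 1 + (b - 1) < card X - 2"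
            using num a1 N4 cX(1) by auto
          have "cross_intersecting (trace ?U {u} H) (trace ?U {v} B)"
            using cross_intersecting_trace[OF step.prems(2)] uv(3) by simp
          note K = card_layer_cross_nonempty[OF cX(2) sub subB this ne sz n(1-4), unfolded cX(1)]
          show ?thesis using K[THEN conjunct1] K[THEN conjunct2, rule_format] le n(5,6) by auto
        qed
        \<comment> \<open>Every member meets \<open>{i, j}\<close>, so the size bound drops from
          \<open>Suc q\<close> to \<open>q\<close>; all of \<open>H\<close> is retained so that
          still no element is common to all.\<close>
        define H' where "H' = (\<lambda>T. T - ?U) ` H"
        have H': "H' \<subseteq> Pow ?X" using step.hyps(1) by (auto simp: H'_def)
        have "centerless ?X H'" using step.prems(3) by (auto simp: centerless_def H'_def)
        have sz': "\<forall>T\<in>H'. card T \<le> q"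
        proof
          fix T' assume "T' \<in> H'"
          then obtain T where T: "T \<in> H" "T' = T - ?U" by (auto simp: H'_def)
          have "T \<inter> ?U \<noteq> {}" using cover[OF T(1)] by auto
          then have "card (T \<inter> ?U) \<ge> 1" by (simp add: Suc_le_eq card_gt_0_iff)
          moreover have "card T \<le> Suc q" using step.prems(4) T by blast
          ultimately show "card T' \<le> q" using T(2) card_minus_trace[of ?U T "T \<inter> ?U"] by simp
        qed
        have subB: "trace ?U {} B \<subseteq> subsets_of_card ?X b"
          using trace_subsets_of_card[OF _ step.prems(1), of ?U "{}"] by simp
        have cross': "cross_intersecting H' (trace ?U {} B)"
          unfolding cross_intersecting_def H'_def trace_def
          using cross_intersectingD[OF step.prems(2)] by fastforce
        have both: "int (card (trace ?U ?U L) + card (trace ?U {} B)) \<le> two_set_count (card X - 2) q q b \<and>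
          (0 < card (trace ?U ?U L) \<and> a + b < card X \<longrightarrow>
            int (card (trace ?U ?U L) + card (trace ?U {} B)) < two_set_count (card X - 2) q q b)"
        proof (cases "a = 1")
          \<comment> \<open>A singleton cannot contain both points, and \<open>a - 2\<close> would
            be truncated; the transversal bound takes over.\<close>
          case True
          have "trace ?U ?U L = {}"
          proof (rule ccontr)
            assume "trace ?U ?U L \<noteq> {}"
            then obtain T where T: "T \<in> L" "?U \<subseteq> T" by (auto simp: trace_def)
            then have "card ?U \<le> card T" using step.hyps(1) LH finite_subset[OF _ fX] by (intro card_mono) auto
            then show False using T True ij by (simp add: L_def)
          qed
          moreover have "?X \<noteq> {}" using cX N4 by (intro notI) simp
          ultimately show ?thesis
            using card_transversals_centerless[OF cX(2) H' \<open>centerless ?X H'\<close> sz' _ _ _ subB cross'] num cX b3 by simp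
        next
          case False
          then have a2: "a \<ge> 2" using a1 by simp
          have "trace ?U ?U L \<subseteq> {T \<in> H'. card T = a - 2}"
            using card_minus_trace[of ?U _ ?U] ij by (fastforce simp: trace_def L_def H'_def)
          moreover have "finite H'" using fin by (simp add: H'_def)
          ultimately have le: "card (trace ?U ?U L) \<le> card {T \<in> H'. card T = a - 2}"
            by (intro card_mono) auto
          \<comment> \<open>The fifth inequality is weaker than \<open>a + 2 \<le> b\<close>, so the
            first alternative of the strict claim holds automatically one level down.\<close>
          have n: "a - 2 + 1 \<le> q" "a - 2 + 2 \<le> b" "a - 2 + b \<le> card ?X" "2 * q \<le> card ?X"
            "a - 2 + 3 \<le> b" "a + b < card X \<Longrightarrow> a - 2 + b < card X - 2"
            using num a2 N4 cX(1) by auto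
          note K = Suc.IH[OF cX(2) H' subB cross' \<open>centerless ?X H'\<close> sz' n(1-4), unfolded cX(1)]
          show ?thesis using K[THEN conjunct1] K[THEN conjunct2, rule_format] le n(5,6) by auto
        qed
        have "card (trace ?U ?U B) \<le> card (subsets_of_card ?X (b - 2))"
          using trace_subsets_of_card[OF _ step.prems(1), of ?U ?U] ij cX(2) by (intro card_mono) (auto simp: numeral_2_eq_2)
        then have BU: "int (card (trace ?U ?U B)) \<le> int ((card X - 2) choose (b - 2))"
          using n_subsets[OF cX(2)] cX(1) by simp
        have total: "two_set_count (card X) (Suc q) (Suc q) b = int ((card X - 2) choose (b - 2))
          + 2 * (int ((card X - 2) choose (b - 1)) - int ((card X - 2 - q) choose (b - 1)))
          + two_set_count (card X - 2) q q b"
          using two_set_count_remove_both[of b q "card X"] num by simp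
        note cL = card_eq_sum_traces[OF finL ij] and cB = card_eq_sum_traces[OF fin(2) ij]
        have "card L = card (trace ?U {i} L) + card (trace ?U {j} L) + card (trace ?U ?U L)"
          using cL Lempty by simp
        moreover note part[of i j] part[of j i] both BU total cB
        moreover have "0 < card (trace ?U {i} L) \<or> 0 < card (trace ?U {j} L) \<or> 0 < card (trace ?U ?U L)"
          using calculation(1) False by linarith
        ultimately show "int (card L + card B) \<le> two_set_count (card X) (Suc q) (Suc q) b \<and>
          (0 < card L \<and> a + b < card X \<and> (a + 3 \<le> b \<or> 2 \<le> Suc q \<and> Suc q + b \<le> card X) \<longrightarrow>
          int (card L + card B) < two_set_count (card X) (Suc q) (Suc q) b)"
          using ij by simp linarith
      qed
    qed
  qed
qed

section \<open>Pairs without common elements\<close>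

lemma shifted_centerless_pair:
  fixes X :: "nat set"
  assumes "finite X" "F \<subseteq> subsets_of_card X k" "G \<subseteq> subsets_of_card X k" "shifted X F" "shifted X G"
    and "cross_intersecting F G" "centerless X F" "centerless X G" "2 \<le> k" "2 * k < card X"
  shows "int (card F + card G) \<le> 2 + two_set_count (card X) k k k"
    and "3 \<le> k \<Longrightarrow> int (card F + card G) < 2 + two_set_count (card X) k k k"
proof -
  obtain P where P: "initial P X" "card P = k + 1"
    using initial_exists[OF assms(1), of "k + 1"] assms(9,10) by auto
  have heavy: "\<forall>T\<in>G. 2 \<le> card (T \<inter> P)" if "F \<subseteq> subsets_of_card X k" "shifted X F"
    "cross_intersecting F G" "centerless X F" for F G
  proof -
    have "F \<subseteq> Pow X" "\<forall>T\<in>F. card T \<le> k" using that(1) by auto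
    then show ?thesis using heavy_of_shifted[OF assms(1) that(2) _ P _ that(4,3)] by blast
  qed
  \<comment> \<open>The correction \<open>1\<close> is absent at \<open>2 * k\<close> and is gained
    in passing to \<open>2 * k + 1\<close>: for \<open>k \<ge> 3\<close> the heavy
    \<open>(k - 1)\<close>-sets are strictly fewer than the increment of
    \<open>two_set_count\<close>.\<close>
  define f where "f N = 2 + two_set_count N k k k - (if 3 \<le> k \<and> 2 * k < N then 1 else 0)" for N
  have "int (card F + card G) \<le> f (card X)"
  proof (rule cross_shifted_sum[where c = 2, OF assms(1) P(1) assms(2-6)])
    show "\<forall>T\<in>F. 2 \<le> card (T \<inter> P)" "\<forall>T\<in>G. 2 \<le> card (T \<inter> P)"
      using heavy[OF assms(2,4,6,7)] heavy[OF assms(3,5) cross_intersecting_sym[OF assms(6)] assms(8)] by auto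
    show "int ((2 * k) choose k) \<le> f (2 * k)"
      using assms(9) by (simp add: f_def two_set_count_def mult_2)
    fix Y assume Y: "finite Y" "P \<subseteq> Y" "2 * k \<le> card Y"
    have "two_set_count (card Y + 1) k k k = two_set_count (card Y) k k k + two_set_count (card Y) k k (k - 1)"
      using two_set_count_remove_outside[of k k k "card Y + 1"] Y(3) assms(9) by simp
    moreover have "int (card (heavy Y P (k - 1) 2)) \<le> two_set_count (card Y) k k (k - 1)"
      "3 \<le> k \<Longrightarrow> int (card (heavy Y P (k - 1) 2)) < two_set_count (card Y) k k (k - 1)"
      using card_heavy_two[OF Y(1,2) P(2), of "k - 1"] Y(3) assms(9) by simp_all
    ultimately show "f (card Y) + int (card (heavy Y P (k - 1) 2)) \<le> f (card Y + 1)"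
      unfolding f_def by auto
  qed (use P assms(9,10) in auto)
  then show "int (card F + card G) \<le> 2 + two_set_count (card X) k k k"
    and "3 \<le> k \<Longrightarrow> int (card F + card G) < 2 + two_set_count (card X) k k k"
    using assms(10) by (auto simp: f_def split: if_splits)
qed

text \<open>If the bound for the traces avoiding \<open>{i, j}\<close> is attained, the traces of \<open>F\<close> are two
  disjoint \<open>(k - 1)\<close>-sets.\<close>

lemma traces_of_equality:
  fixes X :: "'a set"
  assumes "finite X" "H \<subseteq> subsets_of_card X q" "B \<subseteq> subsets_of_card X b" "cross_intersecting H B"
    and "centerless X H" "q \<ge> 1" "b \<ge> 2" "q + b \<le> card X" "2 * q \<le> card X"
    and "int (card B) = two_set_count (card X) q q b" "Q \<in> H"
  shows "\<exists>R. H \<subseteq> {Q, R}"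
proof -
  have Q: "Q \<subseteq> X" "card Q = q" using assms(2,11) by auto
  have eX: "e \<inter> X = e" "card e = q" if "e \<in> H" for e using assms(2) that by auto
  have meet: "T \<inter> e \<noteq> {}" if "T \<in> B" "e \<in> H" for T e
    using cross_intersectingD[OF assms(4) that(2,1)] by blast
  let ?S = "{T. T \<subseteq> X \<and> card T = b \<and> T \<inter> Q \<noteq> {} \<and> (\<forall>e\<in>H. T \<inter> e \<noteq> {})}"
  have "B \<subseteq> ?S" using assms(3,11) meet by blast
  then have le: "card B \<le> card ?S" using assms(1) by (intro card_mono) auto
  have cov: "\<exists>e\<in>H. x \<notin> e \<and> card (e \<inter> X) \<le> q" if "x \<in> Q" for x
    using assms(5) that Q(1) eX unfolding centerless_def by (metis order_refl subsetD)
  \<comment> \<open>A member meeting \<open>Q\<close> without containing it would make the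
    transversal count strict, against the assumed equality.\<close>
  have dich: "e \<inter> Q = {}" if "e \<in> H" "x \<in> Q" "x \<notin> e" for e x
  proof (rule ccontr)
    assume "e \<inter> Q \<noteq> {}"
    then obtain y where y: "y \<in> e" "y \<in> Q" by blast
    have "card (e \<inter> X) \<le> q" using eX that by simp
    then have "int (card ?S) < two_set_count (card X) q q b"
      using card_transversals_less[OF assms(1) Q _ assms(7,8) cov that(2) y(2) that(1,3) y(1)] assms(9) by simp
    then show False using le assms(10) by linarith
  qed
  have "Q \<noteq> {}" using Q(2) assms(6) by auto
  then obtain x R where R: "x \<in> Q" "R \<in> H" "x \<notin> R" using cov by blast
  then have disj: "Q \<inter> R = {}" using dich by blast
  have RX: "R \<subseteq> X" "card R = q" using R(2) assms(2) by auto
  let ?E = "{T. T \<subseteq> X \<and> card T = b \<and> T \<inter> Q \<noteq> {} \<and> T \<inter> R \<noteq> {}}"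
  \<comment> \<open>Equal counts force \<open>B\<close> to contain every \<open>b\<close>-set
    meeting both \<open>Q\<close> and \<open>R\<close>.\<close>
  have "int (card ?E) = int (card B)"
    using card_subsets_meeting_two[OF assms(1) Q(1) RX(1) disj, of b] Q(2) RX(2) assms(10) by simp
  moreover have "B \<subseteq> ?E" using assms(3,11) R(2) meet by blast
  moreover have "finite ?E" using assms(1) by simp
  ultimately have BE: "B = ?E" by (intro card_subset_eq) auto
  have "e \<in> {Q, R}" if e: "e \<in> H" for e
  proof (rule ccontr)
    assume "e \<notin> {Q, R}"
    have fin: "finite e" "finite Q" "finite R" using e Q RX assms(1,2) finite_subset by (blast, blast, blast)
    have "\<not> Q \<subseteq> e" "\<not> R \<subseteq> e"
      using \<open>e \<notin> {Q, R}\<close> card_subset_eq[OF fin(1)] eX(2)[OF e] Q(2) RX(2) by auto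
    \<comment> \<open>A \<open>b\<close>-set through \<open>y\<close> and \<open>z\<close> that
      avoids \<open>e\<close> would lie in \<open>B\<close> and miss \<open>e\<close>.\<close>
    then obtain y z where yz: "y \<in> Q" "y \<notin> e" "z \<in> R" "z \<notin> e" by blast
    have "card {y, z} \<le> b" using assms(7) by (simp add: card_insert_if)
    moreover have "b \<le> card (X - e)"
      using assms(2,8) e fin by (auto simp: card_Diff_subset)
    moreover have "{y, z} \<subseteq> X - e" using yz Q(1) RX(1) by auto
    ultimately obtain T where T: "{y, z} \<subseteq> T" "T \<subseteq> X - e" "card T = b"
      using exists_subset_between[of "{y, z}" b "X - e"] assms(1) by auto
    then have "T \<in> B" unfolding BE using yz by auto
    then show False using meet[OF _ e] T(2) by blast
  qed
  then show ?thesis by blast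
qed

text \<open>The hypothesis \<open>maximal\<close> makes the one-point traces of \<open>G\<close>
  non-empty. If every member of \<open>G\<close> containing \<open>i\<close> contained
  \<open>j\<close>, then exchanging \<open>i\<close> for \<open>j\<close> in a member of
  \<open>F\<close> would preserve meeting all of \<open>G\<close>, so both versions would lie in
  \<open>F\<close>, against \<open>noswap\<close>; likewise with \<open>i\<close> and
  \<open>j\<close> interchanged. Thus \<open>card_cross_intersecting_nonempty\<close> applies to
  both mixed pairs of traces.\<close>

lemma covered_pair:
  fixes X :: "nat set"
  assumes "finite X" "F \<subseteq> subsets_of_card X k" "G \<subseteq> subsets_of_card X k" "cross_intersecting F G"
    and "centerless X F" "2 \<le> k" "2 * k < card X" "i \<in> X" "j \<in> X" "i \<noteq> j"
    and cover: "\<And>T. T \<in> F \<Longrightarrow> i \<in> T \<or> j \<in> T"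
    and noswap: "\<And>T. T \<in> F \<Longrightarrow> j \<in> T \<Longrightarrow> i \<notin> T \<Longrightarrow> insert i (T - {j}) \<notin> F"
    and maximal: "\<And>T. T \<subseteq> X \<Longrightarrow> card T = k \<Longrightarrow> (\<And>S. S \<in> G \<Longrightarrow> T \<inter> S \<noteq> {}) \<Longrightarrow> T \<in> F"
  shows "int (card F + card G) \<le> 2 + two_set_count (card X) k k k \<and>
    (3 \<le> k \<and> int (card F + card G) = 2 + two_set_count (card X) k k k \<longrightarrow> card F = 2)"
proof -
  note fX = assms(1)
  let ?U = "{i, j}"
  let ?X = "X - ?U"
  have cX: "card ?X = card X - 2" "finite ?X" using assms(8-10) fX by auto
  have fin: "finite F" "finite G" using assms(2,3) fX finite_subset[OF _ finite_subsets_of_card'] by blast+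
  have cardF: "card T = k" "finite T" "T \<subseteq> X" if "T \<in> F" for T
    using that assms(2) finite_subset[OF _ fX] by auto
  have meet: "T \<inter> S \<noteq> {}" if "T \<in> F" "S \<in> G" for T S using cross_intersectingD[OF assms(4) that] .
  have Fempty: "trace ?U {} F = {}" using cover by (auto simp: trace_def)
  obtain Ti Tj where "Ti \<in> F" "j \<notin> Ti" "Tj \<in> F" "i \<notin> Tj"
    using assms(5,8,9) by (meson centerless_def)
  moreover from this have "Ti \<inter> ?U = {i}" "Tj \<inter> ?U = {j}" using cover by blast+
  ultimately have ex_i: "\<exists>T\<in>F. T \<inter> ?U = {i}" and ex_j: "\<exists>T\<in>F. T \<inter> ?U = {j}" by blast+
  have swap_in: "insert v (T - {u}) \<in> F" if T: "T \<in> F" "u \<in> T" "v \<notin> T" "v \<in> X"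
    and S: "\<And>S. S \<in> G \<Longrightarrow> u \<in> S \<Longrightarrow> v \<in> S" for T u v
  proof (rule maximal)
    show "insert v (T - {u}) \<subseteq> X" using cardF(3)[OF T(1)] T(4) by auto
    show "card (insert v (T - {u})) = k"
      using card_Suc_Diff1[OF cardF(2)[OF T(1)] T(2)] cardF[OF T(1)] T(3) by simp
    show "insert v (T - {u}) \<inter> S \<noteq> {}" if "S \<in> G" for S
      using meet[OF T(1) that] S[OF that] by blast
  qed
  have Gi: "trace ?U {i} G \<noteq> {}"
  proof
    assume "trace ?U {i} G = {}"
    then have no: "\<And>S. S \<in> G \<Longrightarrow> i \<in> S \<Longrightarrow> j \<in> S" by (auto simp: trace_def)
    obtain T where T: "T \<in> F" "T \<inter> ?U = {i}" using ex_i by blast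
    then have iT: "i \<in> T" "j \<notin> T" using assms(10) by auto
    have "insert j (T - {i}) \<in> F" using swap_in[OF T(1) iT assms(9) no] .
    moreover have "insert i (insert j (T - {i}) - {j}) = T" using iT by auto
    ultimately show False using noswap[of "insert j (T - {i})"] assms(10) T(1) by auto
  qed
  have Gj: "trace ?U {j} G \<noteq> {}"
  proof
    assume "trace ?U {j} G = {}"
    then have no: "\<And>S. S \<in> G \<Longrightarrow> j \<in> S \<Longrightarrow> i \<in> S" by (auto simp: trace_def)
    obtain T where T: "T \<in> F" "T \<inter> ?U = {j}" using ex_j by blast
    then have jT: "j \<in> T" "i \<notin> T" using assms(10) by auto
    show False using swap_in[OF T(1) jT assms(8) no] noswap[OF T(1) jT] by blast
  qed
  have Fi: "trace ?U {i} F \<noteq> {}" and Fj: "trace ?U {j} F \<noteq> {}"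
    using ex_i ex_j by (auto simp: trace_def)
  have sub1: "trace ?U {u} F \<subseteq> subsets_of_card ?X (k - 1)" "trace ?U {u} G \<subseteq> subsets_of_card ?X (k - 1)" for u
    using trace_subsets_of_card[OF _ assms(2), of ?U "{u}"] trace_subsets_of_card[OF _ assms(3), of ?U "{u}"] by auto
  have cross1: "cross_intersecting (trace ?U {u} F) (trace ?U {v} G)" if "u \<noteq> v" for u v
    using cross_intersecting_trace[OF assms(4)] that by simp
  \<comment> \<open>The decomposition \<open>c' + 2 * c + d\<close> of
    \<open>two_set_count (card X) k k k\<close> deletes one point from each of the two disjoint
    \<open>k\<close>-sets.\<close>
  define c where "c = int ((card X - 2) choose (k - 1)) - int ((card X - 2 - (k - 1)) choose (k - 1))"
  define c' where "c' = int ((card X - 2) choose (k - 2))"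
  define d where "d = two_set_count (card X - 2) (k - 1) (k - 1) k"
  have n0: "1 \<le> k - 1" "2 * (k - 1) \<le> card X - 2" "j \<noteq> i" using assms(6,7,10) by auto
  have part: "int (card (trace ?U {i} F) + card (trace ?U {j} G))
      \<le> 1 + c"
    "int (card (trace ?U {j} F) + card (trace ?U {i} G))
      \<le> 1 + c"
    using card_cross_intersecting_nonempty[OF cX(2) sub1 cross1 Fi Gj, unfolded cX(1)]
      card_cross_intersecting_nonempty[OF cX(2) sub1 cross1 Fj Gi, unfolded cX(1)] assms(10) n0
    unfolding c_def by (simp_all only: add_diff_eq simp_thms)
  define H where "H = (\<lambda>T. T - ?U) ` F"
  have H: "H \<subseteq> Pow ?X" using assms(2) by (auto simp: H_def)
  have cent: "centerless ?X H" using assms(5) by (auto simp: centerless_def H_def)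
  have szH: "\<forall>T\<in>H. card T \<le> k - 1"
  proof
    fix T' assume "T' \<in> H"
    then obtain T where T: "T \<in> F" "T' = T - ?U" by (auto simp: H_def)
    have "T \<inter> ?U \<noteq> {}" using cover[OF T(1)] by auto
    then have "card (T \<inter> ?U) \<ge> 1" by (simp add: Suc_le_eq card_gt_0_iff)
    then show "card T' \<le> k - 1" using T cardF(1) card_minus_trace[of ?U T "T \<inter> ?U"] by simp
  qed
  have sub0: "trace ?U {} G \<subseteq> subsets_of_card ?X k"
    using trace_subsets_of_card[OF _ assms(3), of ?U "{}"] by simp
  have cross0: "cross_intersecting H (trace ?U {} G)"
    unfolding cross_intersecting_def H_def trace_def using meet by fastforce
  have n: "k - 2 + 1 \<le> k - 1" "k - 2 + 2 \<le> k" "k - 2 + k \<le> card ?X" "2 * (k - 1) \<le> card ?X"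
    "k - 2 + k < card X - 2" "k - 1 + k \<le> card X - 2" using assms(6,7) cX(1) by auto
  \<comment> \<open>With \<open>a = k - 2\<close>, \<open>q = k - 1\<close> and \<open>b = k\<close>
    the alternative \<open>a + 3 \<le> b\<close> fails, so strictness rests on
    \<open>2 \<le> k - 1\<close>; this is where \<open>k \<ge> 3\<close> enters.\<close>
  note W = card_layer_cross_centerless[OF cX(2) H sub0 cross0 cent szH n(1-4), unfolded cX(1), folded d_def]
  have "trace ?U ?U F \<subseteq> {T \<in> H. card T = k - 2}"
  proof
    fix T' assume "T' \<in> trace ?U ?U F"
    then obtain T where T: "T \<in> F" "T \<inter> ?U = ?U" "T' = T - ?U" by (auto simp: trace_def)
    then have "card T' = k - 2" using card_minus_trace[OF _ T(2)] cardF(1) assms(10) by simp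
    then show "T' \<in> {T \<in> H. card T = k - 2}" using T by (auto simp: H_def)
  qed
  moreover have finH: "finite H" using fin by (simp add: H_def)
  ultimately have le: "card (trace ?U ?U F) \<le> card {T \<in> H. card T = k - 2}" by (intro card_mono) auto
  have "card (trace ?U ?U G) \<le> card (subsets_of_card ?X (k - 2))"
    using trace_subsets_of_card[OF _ assms(3), of ?U ?U] assms(10) cX(2)
    by (intro card_mono) (auto simp: numeral_2_eq_2)
  then have GU: "int (card (trace ?U ?U G)) \<le> c'"
    using n_subsets[OF cX(2)] cX(1) by (simp add: c'_def)
  have total: "two_set_count (card X) k k k = c' + 2 * c + d"
    using two_set_count_remove_both[of k "k - 1" "card X"] assms(6,7) by (simp add: c_def c'_def d_def)
  have cF: "card F = card (trace ?U {i} F) + card (trace ?U {j} F) + card (trace ?U ?U F)"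
    using card_eq_sum_traces[OF fin(1) assms(10)] Fempty by simp
  note cG = card_eq_sum_traces[OF fin(2) assms(10)]
  have bound: "int (card F + card G) \<le> 2 + two_set_count (card X) k k k"
    using part le W[THEN conjunct1] GU total cF cG by linarith
  have "card F = 2" if k3: "3 \<le> k" and eq: "int (card F + card G) = 2 + two_set_count (card X) k k k"
  proof -
    have tight: "int (card {T \<in> H. card T = k - 2} + card (trace ?U {} G)) = d"
      using part le W[THEN conjunct1] GU total cF cG eq by linarith
    have "card {T \<in> H. card T = k - 2} = 0"
    proof (rule ccontr)
      assume "card {T \<in> H. card T = k - 2} \<noteq> 0"
      moreover have "2 \<le> k - 1" using k3 by simp
      ultimately show False using W[THEN conjunct2, rule_format] tight n(5,6) by simp
    qed
    then have no: "{T \<in> H. card T = k - 2} = {}" using finH by simp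
    have "finite (trace ?U ?U F)" using fin by (simp add: trace_def)
    then have FU: "trace ?U ?U F = {}" using le no by simp
    have HF: "H = trace ?U {i} F \<union> trace ?U {j} F"
    proof -
      have "T \<inter> ?U = {i} \<or> T \<inter> ?U = {j}" if "T \<in> F" for T
        using cover[OF that] FU that by (auto simp: trace_def)
      then show ?thesis by (auto simp: H_def trace_def)
    qed
    then have subH: "H \<subseteq> subsets_of_card ?X (k - 1)" using sub1 by blast
    obtain Q where Q: "Q \<in> trace ?U {i} F" using Fi by blast
    have "int (card (trace ?U {} G)) = two_set_count (card ?X) (k - 1) (k - 1) k" using tight no cX(1) by (simp add: d_def)
    moreover have "1 \<le> k - 1" "2 \<le> k" "k - 1 + k \<le> card ?X" "Q \<in> H" using k3 n(6) cX(1) Q HF by auto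
    ultimately obtain R where R: "H \<subseteq> {Q, R}"
      using traces_of_equality[OF cX(2) subH sub0 cross0 cent _ _ _ n(4)] by blast
    \<comment> \<open>A trace occurring at both \<open>i\<close> and \<open>j\<close> would put a
      member and its swap into \<open>F\<close>. Hence deleting the pair loses no members and
      \<open>card F = card H\<close>.\<close>
    have disj: "trace ?U {i} F \<inter> trace ?U {j} F = {}"
    proof (rule ccontr)
      assume "trace ?U {i} F \<inter> trace ?U {j} F \<noteq> {}"
      then obtain S T where ST: "S \<in> F" "S \<inter> ?U = {i}" "T \<in> F" "T \<inter> ?U = {j}" "S - ?U = T - ?U"
        by (auto simp: trace_def)
      then have "insert i (T - {j}) = S" "j \<in> T" "i \<notin> T" using assms(10) by blast+
      then show False using noswap[OF ST(3)] ST(1) by blast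
    qed
    have fint: "finite (trace ?U {u} F)" for u using fin by (simp add: trace_def)
    have "card F = card (trace ?U {i} F) + card (trace ?U {j} F)" using cF FU by simp
    also have "\<dots> = card H" unfolding HF using disj fint by (simp add: card_Un_disjoint)
    also have "\<dots> \<le> card {Q, R}" using R by (intro card_mono) auto
    also have "\<dots> \<le> 2" by (simp add: card_insert_if)
    finally have "card F \<le> 2" .
    moreover have "0 < card (trace ?U {i} F)" "0 < card (trace ?U {j} F)"
      using Fi Fj fint by (auto simp: card_gt_0_iff)
    ultimately show "card F = 2" using cF by simp
  qed
  then show ?thesis using bound by blast
qed

section \<open>Pairs of maximum total size\<close>

definition cross_pair :: "nat set \<Rightarrow> nat \<Rightarrow> nat set set \<Rightarrow> nat set set \<Rightarrow> bool" where
  "cross_pair X k F G \<longleftrightarrow> F \<subseteq> subsets_of_card X k \<and> G \<subseteq> subsets_of_card X k \<and>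
     cross_intersecting F G \<and> centerless X F \<and> centerless X G"

lemma cross_pair_sym: "cross_pair X k F G \<Longrightarrow> cross_pair X k G F"
  by (auto simp: cross_pair_def intro: cross_intersecting_sym)

text \<open>Shifts keep cardinalities, so a shifted pair without common elements is again maximum.
  The equality clause speaks of cardinalities only and can therefore be pulled back through shifts;
  the sets themselves are identified afterwards, for the original pair.\<close>

lemma cross_pair_bound_maximum:
  fixes X :: "nat set"
  assumes "finite X" "2 \<le> k" "2 * k < card X" "cross_pair X k F G"
    and "\<And>F' G'. cross_pair X k F' G' \<Longrightarrow> card F' + card G' \<le> card F + card G"
  shows "int (card F + card G) \<le> 2 + two_set_count (card X) k k k \<and>
    (3 \<le> k \<and> int (card F + card G) = 2 + two_set_count (card X) k k k \<longrightarrow> card F = 2 \<or> card G = 2)"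
proof -
  have step_covered: "int (card F + card G) \<le> 2 + two_set_count (card X) k k k \<and>
    (3 \<le> k \<and> int (card F + card G) = 2 + two_set_count (card X) k k k \<longrightarrow> card F = 2)"
    if FG: "cross_pair X k F G" "\<And>F' G'. cross_pair X k F' G' \<Longrightarrow> card F' + card G' \<le> card F + card G"
      and ij: "i \<in> X" "j \<in> X" "i < j" and nc: "\<not> centerless X (shift i j F)" for F G i j
  proof -
    have F: "F \<subseteq> subsets_of_card X k" "G \<subseteq> subsets_of_card X k" "cross_intersecting F G"
      "centerless X F" "centerless X G" using FG(1) by (auto simp: cross_pair_def)
    obtain y where y: "y \<in> X" "\<forall>T\<in>shift i j F. y \<in> T" using nc by (auto simp: centerless_def)
    then have ex: "\<exists>T\<in>F. y \<notin> T" using F(4) by (auto simp: centerless_def)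
    show ?thesis
    proof (rule covered_pair[OF assms(1) F(1-4) assms(2,3) ij(1,2)])
      show "i \<in> T \<or> j \<in> T" if "T \<in> F" for T using shift_common_element(1)[OF y(1) ex y(2) that] .
      show "insert i (T - {j}) \<notin> F" if "T \<in> F" "j \<in> T" "i \<notin> T" for T
        using shift_common_element(2)[OF y(1) ex y(2) that] .
      show "T \<in> F" if T: "T \<subseteq> X" "card T = k" "\<And>S. S \<in> G \<Longrightarrow> T \<inter> S \<noteq> {}" for T
      proof (rule ccontr)
        assume "T \<notin> F"
        \<comment> \<open>Enlarging a family cannot create a common element, so maximality of the
          total size makes \<open>F\<close> contain every \<open>k\<close>-set meeting all of
          \<open>G\<close>.\<close>
        have "cross_pair X k (insert T F) G"
          using F T by (auto simp: cross_pair_def centerless_def cross_intersecting_def)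
        then have "card (insert T F) \<le> card F" using FG(2) by fastforce
        moreover have "finite F" using F(1) assms(1) finite_subset[OF _ finite_subsets_of_card'] by blast
        ultimately show False using \<open>T \<notin> F\<close> by simp
      qed
    qed (use ij in simp)
  qed
  have "F \<subseteq> Pow X" "G \<subseteq> Pow X" using assms(4) by (auto simp: cross_pair_def)
  from assms(1) this assms(4,5) show ?thesis
  proof (induction F G rule: shift_induct)
    case (shifted F G)
    have F: "F \<subseteq> subsets_of_card X k" "G \<subseteq> subsets_of_card X k" "cross_intersecting F G"
      "centerless X F" "centerless X G" using shifted.prems(1) by (auto simp: cross_pair_def)
    show ?case
      using shifted_centerless_pair[OF assms(1) F(1,2) shifted.hyps(3,4) F(3-5) assms(2,3)] by auto
  next
    case (step F G i j)
    have FG: "F \<subseteq> subsets_of_card X k" "G \<subseteq> subsets_of_card X k" "cross_intersecting F G"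
      using step.prems(1) by (auto simp: cross_pair_def)
    consider "\<not> centerless X (shift i j F)" | "\<not> centerless X (shift i j G)"
      | "centerless X (shift i j F)" "centerless X (shift i j G)" by blast
    then show ?case
    proof cases
      case 1
      then show ?thesis using step_covered[OF step.prems step.hyps(3-5)] by blast
    next
      case 2
      have "int (card G + card F) \<le> 2 + two_set_count (card X) k k k \<and>
        (3 \<le> k \<and> int (card G + card F) = 2 + two_set_count (card X) k k k \<longrightarrow> card G = 2)"
      proof (rule step_covered[OF cross_pair_sym[OF step.prems(1)] _ step.hyps(3-5) 2])
        fix F' G' assume "cross_pair X k F' G'"
        then show "card F' + card G' \<le> card G + card F" using step.prems(2)[of F' G'] by simp
      qed
      then show ?thesis by (simp add: add.commute)
    next
      case 3
      then have "cross_pair X k (shift i j F) (shift i j G)"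
        using shift_subsets_of_card[OF assms(1) _ step.hyps(3)] FG cross_intersecting_shift
        by (simp add: cross_pair_def)
      then show ?thesis using step.IH step.prems(2) by simp
    qed
  qed
qed

text \<open>There are finitely many pairs, so a maximum one exists and bounds all others; a pair
  attaining the bound is itself maximum, so the equality clause applies to it.\<close>

theorem card_cross_pair:
  fixes X :: "nat set"
  assumes "finite X" "2 \<le> k" "2 * k < card X" "cross_pair X k F G"
  shows "int (card F + card G) \<le> 2 + two_set_count (card X) k k k"
    and "\<lbrakk>3 \<le> k; int (card F + card G) = 2 + two_set_count (card X) k k k\<rbrakk> \<Longrightarrow> card F = 2 \<or> card G = 2"
proof -
  let ?S = "{(F, G). cross_pair X k F G}"
  have "?S \<subseteq> Pow (Pow X) \<times> Pow (Pow X)" by (auto simp: cross_pair_def)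
  then have "finite ?S" by (rule finite_subset) (simp add: assms(1))
  moreover have "?S \<noteq> {}" using assms(4) by blast
  ultimately have "Max ((\<lambda>(F, G). card F + card G) ` ?S) \<in> (\<lambda>(F, G). card F + card G) ` ?S"
    by (intro Max_in) auto
  then obtain F0 G0 where FG0: "cross_pair X k F0 G0"
    "card F0 + card G0 = Max ((\<lambda>(F, G). card F + card G) ` ?S)" by force
  have max: "card F' + card G' \<le> card F0 + card G0" if "cross_pair X k F' G'" for F' G'
    unfolding FG0(2) using \<open>finite ?S\<close> that by (intro Max_ge) force+
  have bound: "int (card F0 + card G0) \<le> 2 + two_set_count (card X) k k k"
    using cross_pair_bound_maximum[OF assms(1-3) FG0(1) max] by blast
  have le: "card F + card G \<le> card F0 + card G0" using max[OF assms(4)] .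
  show "int (card F + card G) \<le> 2 + two_set_count (card X) k k k" using bound le by linarith
  assume k: "3 \<le> k" and eq: "int (card F + card G) = 2 + two_set_count (card X) k k k"
  have "card F' + card G' \<le> card F + card G" if "cross_pair X k F' G'" for F' G'
    using max[OF that] bound eq by linarith
  then show "card F = 2 \<or> card G = 2" using cross_pair_bound_maximum[OF assms] k eq by blast
qed

section \<open>The extremal problem\<close>

lemma ksubsets_eq: "ksubsets n k = subsets_of_card {1..n} k"
  by (simp add: ksubsets_def)

lemma centerless_if_nontrivial: "nontrivial F \<Longrightarrow> centerless X F"
  unfolding nontrivial_def centerless_def by blast

lemma cross_pair_if_nontrivial:
  assumes "F \<subseteq> ksubsets n k" "G \<subseteq> ksubsets n k" "nontrivial F" "nontrivial G" "cross_intersecting F G"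
  shows "cross_pair {1..n} k F G"
  using assms(1,2,5) centerless_if_nontrivial[OF assms(3)] centerless_if_nontrivial[OF assms(4)]
  by (simp add: cross_pair_def ksubsets_eq)

lemma card_ext_B:
  assumes "A1 \<in> ksubsets n k" "A2 \<in> ksubsets n k" "A1 \<inter> A2 = {}"
  shows "int (card (ext_B n k A1 A2)) = two_set_count n k k k"
  using card_subsets_meeting_two[of "{1..n}" A1 A2 k] assms
  by (simp add: ext_B_def ksubsets_eq conj_assoc)

lemma nontrivial_disjoint_pair: "A1 \<inter> A2 = {} \<Longrightarrow> nontrivial {A1, A2}"
  by (simp add: nontrivial_def)

text \<open>To avoid a given \<open>x\<close>, take a point other than \<open>x\<close> from each of
  \<open>A1\<close> and \<open>A2\<close> and fill up inside \<open>(A1 \<union> A2) - {x}\<close>,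
  which has at least \<open>2 * k - 1 \<ge> k\<close> elements.\<close>

lemma nontrivial_ext_B:
  assumes A: "A1 \<in> ksubsets n k" "A2 \<in> ksubsets n k" "A1 \<inter> A2 = {}" and "2 \<le> k"
  shows "nontrivial (ext_B n k A1 A2)"
proof -
  have sub: "A1 \<subseteq> {1..n}" "A2 \<subseteq> {1..n}" "card A1 = k" "card A2 = k" using A by (auto simp: ksubsets_eq)
  then have fin: "finite A1" "finite A2" using finite_subset by blast+
  have avoid: "\<exists>B\<in>ext_B n k A1 A2. x \<notin> B" for x
  proof -
    have pick: "\<exists>a\<in>A. a \<noteq> x" if "card A = k" for A :: "nat set"
    proof (rule ccontr)
      assume "\<not> ?thesis"
      then have "A \<subseteq> {x}" by auto
      then have "card A \<le> card {x}" by (intro card_mono) auto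
      then show False using that assms(4) by simp
    qed
    obtain a b where ab: "a \<in> A1" "a \<noteq> x" "b \<in> A2" "b \<noteq> x" using pick sub by blast
    have "a \<noteq> b" using ab A(3) by auto
    then have "card {a, b} \<le> k" using assms(4) by simp
    moreover have "k \<le> card ((A1 \<union> A2) - {x})"
    proof -
      have "card (A1 \<union> A2) = 2 * k" using card_Un_disjoint[OF fin A(3)] sub by simp
      then have "card ((A1 \<union> A2) - {x}) \<ge> 2 * k - 1"
        using diff_card_le_card_Diff[of "{x}" "A1 \<union> A2"] by simp
      then show ?thesis using assms(4) by linarith
    qed
    moreover have "{a, b} \<subseteq> (A1 \<union> A2) - {x}" using ab by auto
    ultimately obtain B where B: "{a, b} \<subseteq> B" "B \<subseteq> (A1 \<union> A2) - {x}" "card B = k"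
      using exists_subset_between[of "{a, b}" k "(A1 \<union> A2) - {x}"] fin by auto
    then have "B \<in> ext_B n k A1 A2" using ab sub by (auto simp: ext_B_def ksubsets_eq)
    then show ?thesis using B(2) by blast
  qed
  then show ?thesis unfolding nontrivial_def by blast
qed

lemma cross_intersecting_ext_B: "cross_intersecting {A1, A2} (ext_B n k A1 A2)"
  by (auto simp: cross_intersecting_def ext_B_def)

lemma two_set_count_eq_formula:
  "2 + two_set_count n k k k = 2 + int (n choose k) - 2 * int ((n - k) choose k) + int ((n - 2 * k) choose k)"
proof -
  have "2 + (a - b - b + c) = 2 + a - 2 * b + c" for a b c :: int by simp
  moreover have "n - k - k = n - 2 * k" by simp
  ultimately show ?thesis unfolding two_set_count_def by presburger
qed

lemma h_eq:
  assumes "2 \<le> k" "2 * k < n"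
  shows "int (h n k) = 2 + two_set_count n k k k"
proof -
  let ?S = "{card F + card G | F G. F \<subseteq> ksubsets n k \<and> G \<subseteq> ksubsets n k
      \<and> nontrivial F \<and> nontrivial G \<and> cross_intersecting F G}"
  define A1 A2 where "A1 = {1..k}" and "A2 = {k + 1..2 * k}"
  have A: "A1 \<in> ksubsets n k" "A2 \<in> ksubsets n k" "A1 \<inter> A2 = {}"
    using assms by (auto simp: A1_def A2_def ksubsets_def)
  have ne: "A1 \<noteq> A2" using assms by (auto simp: A1_def A2_def)
  define m where "m = card {A1, A2} + card (ext_B n k A1 A2)"
  have m: "int m = 2 + two_set_count n k k k" using card_ext_B[OF A] ne by (simp add: m_def)
  have mem: "m \<in> ?S"
    unfolding m_def mem_Collect_eq
    using A nontrivial_disjoint_pair[OF A(3)] nontrivial_ext_B[OF A assms(1)] cross_intersecting_ext_B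
    by (intro exI[of _ "{A1, A2}"] exI[of _ "ext_B n k A1 A2"]) (auto simp: ext_B_def)
  have le: "s \<le> m" if s: "s \<in> ?S" for s
  proof -
    obtain F G where FG: "s = card F + card G" and "F \<subseteq> ksubsets n k" "G \<subseteq> ksubsets n k"
      "nontrivial F" "nontrivial G" "cross_intersecting F G" using s unfolding mem_Collect_eq by (elim exE conjE)
    then have cp: "cross_pair {1..n} k F G" by (intro cross_pair_if_nontrivial)
    show ?thesis using card_cross_pair(1)[OF _ assms(1) _ cp] assms(2) FG m by simp
  qed
  then have "finite ?S" by (intro finite_subset[of ?S "{..m}"]) auto
  then have "h n k = m" unfolding h_def using le mem by (intro Max_eqI) auto
  then show ?thesis using m by simp
qed

text \<open>Two sets without common element are disjoint, cross-intersection puts \<open>G\<close>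
  inside \<open>ext_B n k A1 A2\<close>, and the equal cardinalities turn this into
  equality.\<close>

lemma extremal_pair:
  assumes "2 \<le> k" "card F = 2" "nontrivial F" "F \<subseteq> ksubsets n k" "G \<subseteq> ksubsets n k" "cross_intersecting F G"
    and "int (card G) = two_set_count n k k k"
  shows "\<exists>A1 A2. A1 \<in> ksubsets n k \<and> A2 \<in> ksubsets n k \<and> A1 \<inter> A2 = {} \<and> F = {A1, A2} \<and> G = ext_B n k A1 A2"
proof -
  obtain A1 A2 where F: "F = {A1, A2}" using assms(2) by (auto simp: card_2_iff)
  then have A: "A1 \<in> ksubsets n k" "A2 \<in> ksubsets n k" "A1 \<inter> A2 = {}"
    using assms(3,4) by (auto simp: nontrivial_def)
  have "G \<subseteq> ext_B n k A1 A2"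
    using assms(5) cross_intersectingD[OF assms(6)] F by (auto simp: ext_B_def)
  moreover have "finite (ext_B n k A1 A2)" unfolding ext_B_def ksubsets_eq by simp
  moreover have "card G = card (ext_B n k A1 A2)" using card_ext_B[OF A] assms(7) by simp
  ultimately have "G = ext_B n k A1 A2" by (intro card_subset_eq) auto
  then show ?thesis using A F by blast
qed

lemma card_of_permuted:
  assumes "\<sigma> permutes {1..n}" "image \<sigma> ` F = F'"
  shows "card F = card F'"
proof -
  have "inj_on (image \<sigma>) F" using permutes_inj[OF assms(1)] by (auto intro!: inj_onI simp: inj_image_eq_iff)
  then show ?thesis using card_image[of "image \<sigma>" F] assms(2) by simp
qed

theorem theorem1p5:
  fixes n k :: nat
  assumes "k \<ge> 2" and "n > 2 * k"
  shows "int (h n k) = 2 + int (n choose k) - 2 * int ((n - k) choose k) + int ((n - 2 * k) choose k)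
    \<and> (k \<ge> 3 \<longrightarrow>
        (\<forall>F G. F \<subseteq> ksubsets n k \<and> G \<subseteq> ksubsets n k \<and> nontrivial F \<and> nontrivial G
          \<and> cross_intersecting F G \<longrightarrow>
          (card F + card G = h n k \<longleftrightarrow>
           (\<exists>\<sigma> A1 A2. \<sigma> permutes {1..n} \<and> A1 \<in> ksubsets n k \<and> A2 \<in> ksubsets n k \<and> A1 \<inter> A2 = {} \<and>
              ((image \<sigma> ` F = {A1, A2} \<and> image \<sigma> ` G = ext_B n k A1 A2) \<or>
               (image \<sigma> ` G = {A1, A2} \<and> image \<sigma> ` F = ext_B n k A1 A2))))))"
proof (intro conjI impI allI)
  note h = h_eq[OF assms]
  show "int (h n k) = 2 + int (n choose k) - 2 * int ((n - k) choose k) + int ((n - 2 * k) choose k)"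
    using h two_set_count_eq_formula by simp
  fix F G
  assume k3: "k \<ge> 3" and FG: "F \<subseteq> ksubsets n k \<and> G \<subseteq> ksubsets n k \<and> nontrivial F \<and> nontrivial G
    \<and> cross_intersecting F G"
  show "card F + card G = h n k \<longleftrightarrow>
    (\<exists>\<sigma> A1 A2. \<sigma> permutes {1..n} \<and> A1 \<in> ksubsets n k \<and> A2 \<in> ksubsets n k \<and> A1 \<inter> A2 = {} \<and>
      ((image \<sigma> ` F = {A1, A2} \<and> image \<sigma> ` G = ext_B n k A1 A2) \<or>
       (image \<sigma> ` G = {A1, A2} \<and> image \<sigma> ` F = ext_B n k A1 A2)))"
  proof
    assume "card F + card G = h n k"
    then have eq: "int (card F + card G) = 2 + two_set_count n k k k" using h by simp
    have "cross_pair {1..n} k F G" using cross_pair_if_nontrivial FG by blast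
    from card_cross_pair(2)[OF _ assms(1) _ this k3] have "card F = 2 \<or> card G = 2"
      using assms(2) eq by simp
    then show "\<exists>\<sigma> A1 A2. \<sigma> permutes {1..n} \<and> A1 \<in> ksubsets n k \<and> A2 \<in> ksubsets n k \<and> A1 \<inter> A2 = {} \<and>
      ((image \<sigma> ` F = {A1, A2} \<and> image \<sigma> ` G = ext_B n k A1 A2) \<or>
       (image \<sigma> ` G = {A1, A2} \<and> image \<sigma> ` F = ext_B n k A1 A2))"
    proof
      assume "card F = 2"
      then obtain A1 A2 where "A1 \<in> ksubsets n k" "A2 \<in> ksubsets n k" "A1 \<inter> A2 = {}" "F = {A1, A2}" "G = ext_B n k A1 A2"
        using extremal_pair[of k F n G] assms(1) FG eq by auto
      \<comment> \<open>The identity suffices because \<open>A1\<close> and \<open>A2\<close> range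
        over all disjoint pairs.\<close>
      then show ?thesis using permutes_id by (intro exI[of _ id] exI[of _ A1] exI[of _ A2]) simp
    next
      assume "card G = 2"
      then obtain A1 A2 where "A1 \<in> ksubsets n k" "A2 \<in> ksubsets n k" "A1 \<inter> A2 = {}" "G = {A1, A2}" "F = ext_B n k A1 A2"
        using extremal_pair[of k G n F] assms(1) FG eq cross_intersecting_sym by auto
      then show ?thesis using permutes_id by (intro exI[of _ id] exI[of _ A1] exI[of _ A2]) simp
    qed
  next
    assume "\<exists>\<sigma> A1 A2. \<sigma> permutes {1..n} \<and> A1 \<in> ksubsets n k \<and> A2 \<in> ksubsets n k \<and> A1 \<inter> A2 = {} \<and>
      ((image \<sigma> ` F = {A1, A2} \<and> image \<sigma> ` G = ext_B n k A1 A2) \<or>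
       (image \<sigma> ` G = {A1, A2} \<and> image \<sigma> ` F = ext_B n k A1 A2))"
    then obtain \<sigma> A1 A2 where \<sigma>: "\<sigma> permutes {1..n}" and A: "A1 \<in> ksubsets n k" "A2 \<in> ksubsets n k" "A1 \<inter> A2 = {}"
      and im: "(image \<sigma> ` F = {A1, A2} \<and> image \<sigma> ` G = ext_B n k A1 A2) \<or>
       (image \<sigma> ` G = {A1, A2} \<and> image \<sigma> ` F = ext_B n k A1 A2)" by (elim exE conjE)
    from im have "card F + card G = card {A1, A2} + card (ext_B n k A1 A2)"
      using card_of_permuted[OF \<sigma>] by (metis add.commute)
    moreover have "A1 \<noteq> A2" using A assms(1) by (auto simp: ksubsets_def)
    ultimately show "card F + card G = h n k" using card_ext_B[OF A] h by simp
  qed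
qed

end
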